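(* Let $p$ be an odd prime, and let $\mathcal{F}$ be a saturated fusion system on a finite $p$-group $S$. Suppose that every maximal subgroup of $S$ is semi-invariant in $\mathcal{F}$, and, if $S$ is not cyclic, suppose additionally that $S$ has more than one abelian maximal subgroup. Then $\mathcal{F}$ is supersolvable.
   Context: Let $\mathcal{F}$ be a fusion system on a finite $p$-group $S$. Semi-invariant: a subgroup $H\le S$ is semi-invariant in $\mathcal{F}$ if for every subgroup $K$ with $H\le K\le S$ and every $\alpha\in\mathrm{Aut}_{\mathcal{F}}(K)$ one has $H^{\alpha}=H$. Supersolvable: a saturated fusion system $\mathcal{F}$ on $S$ is supersolvable if there is a series of subgroups $1=S_0\le S_1\le\cdots\le S_n=S$ such that each $S_i$ ($0\le i\le n$) is strongly $\mathcal{F}$-closed and $S_{i+1}/S_i$ is cyclic for $0\le i\le n-1$. (A subgroup $T\le S$ is strongly $\mathcal{F}$-closed if for every $P\le T$ and every morphism $\phi\in\mathrm{Hom}_{\mathcal{F}}(P,S)$ one has $P^{\phi}\le T$.) *)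

theory Defs
  imports "HOL-Algebra.Algebra"
begin

locale finite_p_group = group S for p :: nat and S (structure) +
  assumes prime: "Factorial_Ring.prime p"
    and order_power: "\<exists>n. order S = p ^ n"

definition maximal_subgroup :: "'a set \<Rightarrow> ('a, 'b) monoid_scheme \<Rightarrow> bool" where
  "maximal_subgroup M G \<longleftrightarrow>
     subgroup M G \<and> M \<noteq> carrier G \<and>
     (\<forall>H. subgroup H G \<longrightarrow> M \<subseteq> H \<longrightarrow> H = M \<or> H = carrier G)"

definition sylow_subgroup :: "nat \<Rightarrow> 'a set \<Rightarrow> ('a, 'b) monoid_scheme \<Rightarrow> bool" where
  "sylow_subgroup p Q G \<longleftrightarrow> subgroup Q G \<and> card Q = p ^ multiplicity p (order G)"

text \<open>
  The morphism sets of a fusion system on \<open>S\<close> are given by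
  \<open>F :: 'a set \<Rightarrow> 'a set \<Rightarrow> ('a \<Rightarrow> 'a) set\<close>, where \<open>F P Q\<close> plays the role of
  \<open>Hom\<^sub>\<F>(P, Q)\<close> and \<open>F P P\<close> that of \<open>Aut\<^sub>\<F>(P)\<close>
  (an injective endomorphism of a finite group is an automorphism).  Its values matter only
  when \<open>P\<close> and \<open>Q\<close> are subgroups of \<open>S\<close>.  Morphisms with source \<open>P\<close> take the value
  \<open>undefined\<close> outside \<open>P\<close>, so that equality of morphisms is equality of HOL functions, and
  they are composed with \<^const>\<open>compose\<close>.  Maps are written on the left and conjugation is
  \<open>x \<mapsto> g x g\<inverse>\<close>; as \<open>g\<close> ranges over a group, the choice of side is immaterial.
\<close>

text \<open>The set \<open>Hom\<^sub>S(P, Q)\<close>; in particular \<open>conj_hom S P P\<close> is \<open>Aut\<^sub>S(P)\<close>.\<close>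

definition conj_hom :: "('a, 'b) monoid_scheme \<Rightarrow> 'a set \<Rightarrow> 'a set \<Rightarrow> ('a \<Rightarrow> 'a) set" where
  "conj_hom S P Q =
     {\<lambda>x\<in>P. g \<otimes>\<^bsub>S\<^esub> x \<otimes>\<^bsub>S\<^esub> inv\<^bsub>S\<^esub> g | g.
        g \<in> carrier S \<and> (\<forall>x\<in>P. g \<otimes>\<^bsub>S\<^esub> x \<otimes>\<^bsub>S\<^esub> inv\<^bsub>S\<^esub> g \<in> Q)}"

text \<open>
  Inclusions and identities are conjugations by \<open>\<one>\<close>, so the third and fourth axioms say that
  \<open>F\<close> is a category containing all \<open>S\<close>-conjugations, and the last one that every morphism is
  an \<open>F\<close>-isomorphism onto its image, followed by an inclusion.
\<close>

locale fusion_system = finite_p_group p S for p :: nat and S (structure) +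
  fixes F :: "'a set \<Rightarrow> 'a set \<Rightarrow> ('a \<Rightarrow> 'a) set"
  assumes morphism_mon:
      "\<lbrakk>subgroup P S; subgroup Q S; \<phi> \<in> F P Q\<rbrakk>
       \<Longrightarrow> \<phi> \<in> mon (S\<lparr>carrier := P\<rparr>) (S\<lparr>carrier := Q\<rparr>)"
    and morphism_extensional:
      "\<lbrakk>subgroup P S; subgroup Q S; \<phi> \<in> F P Q\<rbrakk> \<Longrightarrow> \<phi> \<in> extensional P"
    and conj_morphism:
      "\<lbrakk>subgroup P S; subgroup Q S\<rbrakk> \<Longrightarrow> conj_hom S P Q \<subseteq> F P Q"
    and compose_morphism:
      "\<lbrakk>subgroup P S; subgroup Q S; subgroup R S; \<phi> \<in> F P Q; \<psi> \<in> F Q R\<rbrakk>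
       \<Longrightarrow> compose P \<psi> \<phi> \<in> F P R"
    and iso_onto_image:
      "\<lbrakk>subgroup P S; subgroup Q S; \<phi> \<in> F P Q\<rbrakk>
       \<Longrightarrow> \<phi> \<in> F P (\<phi> ` P) \<and> restrict (inv_into P \<phi>) (\<phi> ` P) \<in> F (\<phi> ` P) P"

definition fully_automized ::
  "nat \<Rightarrow> ('a, 'b) monoid_scheme \<Rightarrow> ('a set \<Rightarrow> 'a set \<Rightarrow> ('a \<Rightarrow> 'a) set) \<Rightarrow> 'a set \<Rightarrow> bool" where
  "fully_automized p S F P \<longleftrightarrow>
     sylow_subgroup p (conj_hom S P P) (AutoGroup (S\<lparr>carrier := P\<rparr>)\<lparr>carrier := F P P\<rparr>)"

text \<open>
  For an isomorphism \<open>\<phi> : Q \<rightarrow> P\<close> the subgroup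
  \<open>N\<^sub>\<phi> = {g \<in> N\<^sub>S(Q). \<phi> c\<^sub>g \<phi>\<inverse> \<in> Aut\<^sub>S(P)}\<close>, where \<open>c\<^sub>g\<close> is conjugation by \<open>g\<close> on \<open>Q\<close>.
\<close>

definition extension_domain ::
  "('a, 'b) monoid_scheme \<Rightarrow> 'a set \<Rightarrow> 'a set \<Rightarrow> ('a \<Rightarrow> 'a) \<Rightarrow> 'a set" where
  "extension_domain S Q P \<phi> =
     {g \<in> normalizer S Q.
        (\<lambda>x\<in>P. \<phi> (g \<otimes>\<^bsub>S\<^esub> inv_into Q \<phi> x \<otimes>\<^bsub>S\<^esub> inv\<^bsub>S\<^esub> g)) \<in> conj_hom S P P}"

definition receptive ::
  "('a, 'b) monoid_scheme \<Rightarrow> ('a set \<Rightarrow> 'a set \<Rightarrow> ('a \<Rightarrow> 'a) set) \<Rightarrow> 'a set \<Rightarrow> bool" where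
  "receptive S F P \<longleftrightarrow>
     (\<forall>Q \<phi>. subgroup Q S \<and> \<phi> \<in> F Q P \<and> \<phi> ` Q = P \<longrightarrow>
        (\<exists>\<psi> \<in> F (extension_domain S Q P \<phi>) (carrier S). \<forall>x\<in>Q. \<psi> x = \<phi> x))"

text \<open>
  Saturation in the form of Roberts--Shpectorov and Aschbacher--Kessar--Oliver: every
  \<open>F\<close>-conjugacy class of subgroups contains a member that is fully automized and receptive.
\<close>

locale saturated_fusion_system = fusion_system p S F
  for p :: nat and S (structure) and F +
  assumes saturated:
    "subgroup P S \<Longrightarrow>
     \<exists>Q. subgroup Q S \<and> (\<exists>\<phi> \<in> F P Q. \<phi> ` P = Q) \<and> fully_automized p S F Q \<and> receptive S F Q"

definition semi_invariant ::
  "('a, 'b) monoid_scheme \<Rightarrow> ('a set \<Rightarrow> 'a set \<Rightarrow> ('a \<Rightarrow> 'a) set) \<Rightarrow> 'a set \<Rightarrow> bool" where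
  "semi_invariant S F H \<longleftrightarrow>
     subgroup H S \<and>
     (\<forall>K. subgroup K S \<and> H \<subseteq> K \<longrightarrow> (\<forall>\<alpha> \<in> F K K. \<alpha> ` H = H))"

definition strongly_closed ::
  "('a, 'b) monoid_scheme \<Rightarrow> ('a set \<Rightarrow> 'a set \<Rightarrow> ('a \<Rightarrow> 'a) set) \<Rightarrow> 'a set \<Rightarrow> bool" where
  "strongly_closed S F T \<longleftrightarrow>
     subgroup T S \<and>
     (\<forall>P. subgroup P S \<and> P \<subseteq> T \<longrightarrow> (\<forall>\<phi> \<in> F P (carrier S). \<phi> ` P \<subseteq> T))"

text \<open>
  A strongly closed subgroup is invariant under conjugation in \<open>S\<close>, so the quotients below are
  quotients by normal subgroups.
\<close>

definition supersolvable ::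
  "nat \<Rightarrow> ('a, 'b) monoid_scheme \<Rightarrow> ('a set \<Rightarrow> 'a set \<Rightarrow> ('a \<Rightarrow> 'a) set) \<Rightarrow> bool" where
  "supersolvable p S F \<longleftrightarrow>
     saturated_fusion_system p S F \<and>
     (\<exists>(n::nat) T. T 0 = {\<one>\<^bsub>S\<^esub>} \<and> T n = carrier S \<and>
        (\<forall>i\<le>n. strongly_closed S F (T i)) \<and>
        (\<forall>i<n. T i \<subseteq> T (Suc i) \<and> cyclic_group (S\<lparr>carrier := T (Suc i)\<rparr> Mod T i)))"

end

theory Submission
  imports Defs
begin

text \<open>
  Let \<open>S\<close> be noncyclic with distinct abelian maximal subgroups \<open>M\<close>, \<open>N\<close>.  Then \<open>M \<inter> N\<close> is
  central, the derived subgroup \<open>D\<close> is central of order at most \<open>p\<close>, and the centralizer of a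
  noncentral element is an abelian maximal subgroup.  For an abelian maximal subgroup \<open>A\<close> of a
  nonabelian \<open>S\<close> that is fully automized and receptive, the Sylow subgroup \<open>Aut\<^sub>S(A)\<close> is normal in
  \<open>Aut\<^sub>\<F>(A)\<close>: otherwise \<open>Aut\<^sub>\<F>(A)\<close> contains a copy of \<open>SL\<^sub>2(p)\<close> acting on a plane of \<open>A\<close>, whose
  central involution extends to an automorphism of \<open>S\<close> in \<open>\<F>\<close>.  That automorphism acts trivially on
  \<open>S/A\<close> but not on \<open>A/Z(S)\<close>, although it leaves all maximal subgroups invariant.  Therefore all
  morphisms on \<open>A\<close> extend to \<open>S\<close>.  Applied to centralizers of elements, this shows that
  \<open>Aut\<^sub>\<F>(S)\<close> controls fusion of elements, so strongly closed subgroups are just the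
  \<open>Aut\<^sub>\<F>(S)\<close>-invariant ones.  Since \<open>Aut\<^sub>\<F>(S)\<close> leaves maximal subgroups invariant, it does the same for every
  \<open>H\<close> containing \<open>D S\<^sup>p\<close>, and for \<open>D H\<^sup>q\<close> with \<open>q\<close> a power of \<open>p\<close>.  These subgroups contain a
  series from \<open>D\<close> to \<open>S\<close> with cyclic factors.
\<close>

subsection \<open>Groups and \<open>p\<close>-groups\<close>

text \<open>Saturation provides a fully automized receptive subgroup \<open>C\<close> only up to
  F-conjugacy, and receptivity extends an isomorphism phi onto \<open>C\<close> only to N_phi. Since
  p-th powers in \<open>S\<close> are central, every phi c_g phi^-1 has p-th power 1; a normal Sylow
  subgroup Aut_S(C) absorbs all of these, and then N_phi = S. Normality of Aut_S(C) is a dichotomy.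
  If phi or phi^-1 sends \<open>D\<close> into the center, commutation arguments suffice. If neither
  does, there are explicit t and u in Aut_F(C) acting on a plane (s, s1), written additively, by t:
  s -> s, s1 -> s + s1 and u: s -> s - s1, s1 -> s1. Then i = (tut)^2 is computed directly, without
  any structure theory of SL_2(p). The point to check is that i commutes with Aut_S(C), which gives
  N_i = S. The extension of i forces s1^2 to be central, and p odd turns this into s1 central, a
  contradiction. Fusion of single elements is enough because strong closure can be tested
  elementwise, and the centralizer of an element is either \<open>S\<close> or an abelian maximal
  subgroup, the two kinds of domain from which morphisms are known to come from Aut_F(S).\<close>

lemma (in group) finite_subgroupI:
  assumes fin: "finite (carrier G)" and sub: "H \<subseteq> carrier G" and ne: "H \<noteq> {}"
    and mult: "\<And>a b. \<lbrakk>a \<in> H; b \<in> H\<rbrakk> \<Longrightarrow> a \<otimes> b \<in> H"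
  shows "subgroup H G"
proof (rule subgroupI[OF sub ne _ mult])
  fix a assume a: "a \<in> H"
  have aG: "a \<in> carrier G" using a sub by auto
  have pow: "a [^] Suc n \<in> H" for n :: nat
    by (induction n) (use a aG mult in auto)
  have op: "order G > 0" using fin by (simp add: order_gt_0_iff_finite)
  show "inv a \<in> H"
  proof (cases "order G = 1")
    case True
    then have "carrier G = {\<one>}" by (metis order_one_triv_iff)
    then show ?thesis using a aG by auto
  next
    case False
    \<comment> \<open>Writing the order as n + 2 makes the inverse a positive power of
      \<open>a\<close>, which closure under products reaches without knowing that \<open>H\<close>
      contains the identity.\<close>
    then obtain n where n: "order G = Suc (Suc n)" using op
      by (metis One_nat_def Suc_pred less_one nat_neq_iff not_gr0)
    have "a [^] (Suc n) \<otimes> a = \<one>"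
      using pow_order_eq_1[OF aG] unfolding n by simp
    then have "inv a = a [^] Suc n" using aG by (intro inv_equality) auto
    then show ?thesis using pow by simp
  qed
qed simp_all

lemma (in group) cancel_left_mult:
  assumes "x \<in> carrier G" "y \<in> carrier G"
  shows "inv x \<otimes> (x \<otimes> y) = y" "x \<otimes> (inv x \<otimes> y) = y"
  using assms by (simp_all flip: m_assoc)

lemma (in group) cancel_conj:
  assumes "g \<in> carrier G" "x \<in> carrier G"
  shows "inv g \<otimes> (g \<otimes> x \<otimes> inv g) \<otimes> g = x" "g \<otimes> (inv g \<otimes> x \<otimes> g) \<otimes> inv g = x"
  using assms by (simp_all add: m_assoc cancel_left_mult)

lemma (in group) conj_mult:
  assumes "g \<in> carrier G" "x \<in> carrier G" "y \<in> carrier G"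
  shows "g \<otimes> (x \<otimes> y) \<otimes> inv g = (g \<otimes> x \<otimes> inv g) \<otimes> (g \<otimes> y \<otimes> inv g)"
  using assms by (simp add: m_assoc cancel_left_mult)

lemma (in group) mult_conj:
  assumes "g \<in> carrier G" "h \<in> carrier G" "x \<in> carrier G"
  shows "(g \<otimes> h) \<otimes> x \<otimes> inv (g \<otimes> h) = g \<otimes> (h \<otimes> x \<otimes> inv h) \<otimes> inv g"
  using assms by (simp add: m_assoc inv_mult_group)

lemma (in group) conj_fixes_iff_commute:
  assumes "g \<in> carrier G" "x \<in> carrier G"
  shows "g \<otimes> x \<otimes> inv g = x \<longleftrightarrow> g \<otimes> x = x \<otimes> g"
  using assms by (metis inv_closed inv_solve_right m_closed)

text \<open>Both directions of conjugation are assumed because the group may be infinite, where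
  conjugation by \<open>y\<close> can map \<open>H\<close> properly into itself.\<close>

lemma (in group) subgroup_adjoin:
  assumes H: "subgroup H G" and y: "y \<in> carrier G"
    and norm: "\<And>h. h \<in> H \<Longrightarrow> y \<otimes> h \<otimes> inv y \<in> H" "\<And>h. h \<in> H \<Longrightarrow> inv y \<otimes> h \<otimes> y \<in> H"
  shows "subgroup {h \<otimes> y [^] (k::int) | h k. h \<in> H} G" (is "subgroup ?L G")
proof -
  have HG: "h \<in> carrier G" if "h \<in> H" for h using H that by (rule subgroup.mem_carrier)
  have norm_nat: "y [^] (k::nat) \<otimes> h \<otimes> inv (y [^] k) \<in> H" if "h \<in> H" for h k
  proof (induction k)
    case (Suc k)
    have "y [^] Suc k \<otimes> h \<otimes> inv (y [^] Suc k) = y \<otimes> (y [^] k \<otimes> h \<otimes> inv (y [^] k)) \<otimes> inv y"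
      using y HG[OF that] mult_conj[of y "y [^] k" h] nat_pow_Suc2[OF y, of k] by simp
    then show ?case using norm(1)[OF Suc] by simp
  qed (use that HG in simp)
  have norm_nat': "inv (y [^] (k::nat)) \<otimes> h \<otimes> y [^] k \<in> H" if "h \<in> H" for h k
  proof (induction k)
    case (Suc k)
    have "inv (y [^] Suc k) \<otimes> h \<otimes> y [^] Suc k = inv y \<otimes> (inv (y [^] k) \<otimes> h \<otimes> y [^] k) \<otimes> y"
      using y HG[OF that] by (simp add: m_assoc inv_mult_group)
    then show ?case using norm(2)[OF Suc] by simp
  qed (use that HG in simp)
  have norm_int: "y [^] (k::int) \<otimes> h \<otimes> inv (y [^] k) \<in> H" if "h \<in> H" for h k
  proof (cases k rule: int_cases2)
    case (nonneg n)
    then show ?thesis using norm_nat[OF that, of n] by (simp add: int_pow_int)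
  next
    case (nonpos n)
    then show ?thesis using norm_nat'[OF that, of n] y by (simp add: int_pow_neg_int)
  qed
  show ?thesis
  proof (rule subgroupI)
    show "?L \<subseteq> carrier G" using HG y by auto
    show "?L \<noteq> {}" using subgroup.one_closed[OF H] by auto
  next
    fix a assume "a \<in> ?L"
    then obtain h k where a: "a = h \<otimes> y [^] (k::int)" "h \<in> H" by auto
    have h: "h \<in> carrier G" and yk: "y [^] k \<in> carrier G" using a(2) HG y by auto
    have "inv a = (y [^] (-k) \<otimes> inv h \<otimes> inv (y [^] (-k))) \<otimes> y [^] (-k)"
      unfolding a(1) int_pow_neg[OF y] using h yk by (simp add: inv_mult_group m_assoc)
    then show "inv a \<in> ?L"
      using norm_int[OF subgroup.m_inv_closed[OF H a(2)], of "-k"] by (intro CollectI exI conjI)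
  next
    fix a b assume "a \<in> ?L" "b \<in> ?L"
    then obtain h k h' k' where a: "a = h \<otimes> y [^] (k::int)" "h \<in> H"
      and b: "b = h' \<otimes> y [^] (k'::int)" "h' \<in> H" by auto
    have c: "h \<in> carrier G" "h' \<in> carrier G" "y [^] k \<in> carrier G" "y [^] k' \<in> carrier G"
      using a(2) b(2) HG y by auto
    have "a \<otimes> b = (h \<otimes> (y [^] k \<otimes> h' \<otimes> inv (y [^] k))) \<otimes> y [^] (k + k')"
      unfolding a(1) b(1) int_pow_mult[OF y] using c by (simp add: m_assoc cancel_left_mult)
    then show "a \<otimes> b \<in> ?L"
      using subgroup.m_closed[OF H a(2) norm_int[OF b(2), of k]] by (intro CollectI exI conjI)
  qed
qed

lemma (in group) mem_adjoin:
  assumes H: "subgroup H G" and y: "y \<in> carrier G"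
  shows "H \<subseteq> {h \<otimes> y [^] (k::int) | h k. h \<in> H}" "y \<in> {h \<otimes> y [^] (k::int) | h k. h \<in> H}"
proof -
  have "h = h \<otimes> y [^] (0::int)" if "h \<in> H" for h using subgroup.mem_carrier[OF H that] by simp
  then show "H \<subseteq> {h \<otimes> y [^] (k::int) | h k. h \<in> H}" by blast
  have "y = \<one> \<otimes> y [^] (1::int)" using y by simp
  then show "y \<in> {h \<otimes> y [^] (k::int) | h k. h \<in> H}" using subgroup.one_closed[OF H] by blast
qed

text \<open>The quotient N_G(P)/P has order m prime to p, so u^m lies in \<open>P\<close>. Since u^p
  = 1, a Bezout relation between m and p writes \<open>u\<close> as a power of u^m.\<close>

lemma (in group) normalizing_p_element_in_sylow:
  assumes fin: "finite (carrier G)" and p: "Factorial_Ring.prime p"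
    and P: "sylow_subgroup p P G"
    and u: "u \<in> carrier G" "u [^] (p::nat) = \<one>"
    and norm: "\<And>v. v \<in> P \<Longrightarrow> u \<otimes> v \<otimes> inv u \<in> P"
  shows "u \<in> P"
proof -
  have sP: "subgroup P G" and cP: "card P = p ^ multiplicity p (order G)"
    using P by (auto simp: sylow_subgroup_def)
  have PG: "P \<subseteq> carrier G" using sP by (rule subgroup.subset)
  let ?N = "normalizer G P"
  let ?K = "G\<lparr>carrier := ?N\<rparr>"
  have N: "subgroup ?N G" using PG by (rule normalizer_imp_subgroup)
  have inj: "inj_on (\<lambda>v. u \<otimes> v \<otimes> inv u) P"
    by (rule inj_on_inverseI[where g = "\<lambda>x. inv u \<otimes> x \<otimes> u"])
      (use u PG cancel_conj(1) in blast)
  have "(\<lambda>v. u \<otimes> v \<otimes> inv u) ` P = P"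
    using endo_inj_surj[OF finite_subset[OF PG fin] _ inj] norm by auto
  moreover have "u <# P #> inv u = (\<lambda>v. u \<otimes> v \<otimes> inv u) ` P"
    by (auto simp: l_coset_def r_coset_def)
  ultimately have uN: "u \<in> ?N"
    using u PG unfolding normalizer_def stabilizer_def by simp
  interpret PN: normal P ?K using subgroup_in_normalizer[OF sP] .
  interpret Q: group "?K Mod P" by (rule PN.factorgroup_is_group)
  have lag: "card (rcosets\<^bsub>?K\<^esub> P) * card P = card ?N"
    using group.lagrange[OF PN.is_group PN.subgroup_axioms] by (simp add: order_def)
  have "card ?N dvd order G" using lagrange[OF N] by (metis dvd_triv_right)
  then have dv: "card (rcosets\<^bsub>?K\<^esub> P) * p ^ multiplicity p (order G) dvd order G"
    using lag cP by simp
  let ?m = "card (rcosets\<^bsub>?K\<^esub> P)"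
  have nz: "order G \<noteq> 0" using fin by (simp add: order_gt_0_iff_finite)
  have "\<not> p dvd ?m"
  proof
    assume "p dvd ?m"
    then have "p * p ^ multiplicity p (order G) dvd ?m * p ^ multiplicity p (order G)"
      by (rule mult_dvd_mono) simp
    then have "p ^ Suc (multiplicity p (order G)) dvd order G"
      using dvd_trans[OF _ dv] by simp
    then have "Suc (multiplicity p (order G)) \<le> multiplicity p (order G)"
      using nz p by (intro multiplicity_geI) auto
    then show False by simp
  qed
  then have cop: "coprime ?m p" using p by (simp add: prime_imp_coprime coprime_commute)
  have ou: "order (?K Mod P) = ?m" by (simp add: FactGroup_def order_def)
  have c: "P #>\<^bsub>?K\<^esub> u \<in> carrier (?K Mod P)" using uN by (auto simp: carrier_FactGroup)
  have "P #>\<^bsub>?K\<^esub> (u [^]\<^bsub>?K\<^esub> ?m) = P"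
    using Q.pow_order_eq_1[OF c] PN.FactGroup_pow[of u ?m] uN ou by simp
  then have "P #>\<^bsub>?K\<^esub> (u [^] ?m) = P" by (simp only: nat_pow_consistent[symmetric])
  moreover have umN: "u [^] ?m \<in> carrier ?K"
    using subgroup_int_pow_closed[OF N uN, of "int ?m"] by (simp add: int_pow_int)
  ultimately have um: "u [^] ?m \<in> P"
    using group.rcos_self[OF PN.is_group umN PN.subgroup_axioms] by simp
  obtain a b where ab: "a * int ?m + b * int p = 1"
    using cop bezout_int[of "int ?m" "int p"] by (auto simp: gcd_int_int_eq coprime_iff_gcd_eq_1)
  have "u = u [^] (int ?m * a + int p * b)" using ab u by (simp add: mult.commute)
  also have "\<dots> = (u [^] ?m) [^] a \<otimes> (u [^] p) [^] b"
    using u(1) by (simp only: int_pow_mult int_pow_pow[symmetric] int_pow_int)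
  finally have "u = (u [^] ?m) [^] a" using u by simp
  then show ?thesis using subgroup_int_pow_closed[OF sP um] by metis
qed

section \<open>Maximal subgroups of finite p-groups: normality and p-th powers\<close>

context finite_p_group
begin

lemma finite_carrier: "finite (carrier S)"
  using order_power prime prime_gt_0_nat by (metis order_gt_0_iff_finite zero_less_power)

lemma finite_subgroup: "subgroup H S \<Longrightarrow> finite H"
  using finite_carrier finite_subset subgroup.subset by blast

lemma card_subgroup_power:
  assumes "subgroup H S"
  shows "\<exists>k. card H = p ^ k"
proof -
  obtain n where "order S = p ^ n" using order_power by auto
  then have "card H dvd p ^ n" using lagrange[OF assms] by (metis dvd_triv_right)
  then show ?thesis using prime by (auto simp: divides_primepow_nat)
qed

lemma maximal_subgroup_normalizing_element:
  assumes M: "subgroup M S" "M \<noteq> carrier S"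
  obtains x where "x \<in> carrier S" "x \<notin> M" "\<And>g. g \<in> M \<Longrightarrow> x \<otimes> g \<otimes> inv x \<in> M"
proof -
  \<comment> \<open>The fixed points of \<open>M\<close> on its cosets are the cosets of elements normalizing \<open>M\<close>, and their number is
    divisible by \<open>p\<close>.\<close>
  let ?G = "S\<lparr>carrier := M\<rparr>" and ?E = "rcosets M"
  let ?\<phi> = "\<lambda>g. \<lambda>R\<in>?E. R #> inv g"
  have MS: "g \<in> carrier S" if "g \<in> M" for g using M(1) that by (rule subgroup.mem_carrier)
  have G: "group ?G" using M(1) is_group by (rule subgroup.subgroup_is_group)
  have sub: "R \<subseteq> carrier S" if "R \<in> ?E" for R
    using subgroup.rcosets_carrier[OF M(1) is_group that] .
  have clos: "R #> g \<in> ?E" if "R \<in> ?E" "g \<in> carrier S" for R g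
    using that subgroup.subset[OF M(1)] by (auto simp: RCOSETS_def coset_mult_assoc)
  have bij: "?\<phi> g \<in> Bij ?E" if "g \<in> M" for g
  proof -
    have "bij_betw (?\<phi> g) ?E ?E"
      by (rule bij_betw_byWitness[where f' = "\<lambda>R. R #> g"])
        (use that MS clos sub in \<open>auto simp: coset_mult_assoc\<close>)
    then show ?thesis by (simp add: Bij_def)
  qed
  have hom: "?\<phi> (g \<otimes> h) = compose ?E (?\<phi> g) (?\<phi> h)" if "g \<in> M" "h \<in> M" for g h
    using that MS clos sub
    by (auto simp: compose_def inv_mult_group coset_mult_assoc intro!: restrict_ext)
  have "group_hom ?G (BijGroup ?E) ?\<phi>"
    using bij hom by (intro group_hom.intro G group_BijGroup group_hom_axioms.intro homI)
      (simp_all add: BijGroup_def)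
  then interpret A: group_action ?G ?E ?\<phi> by (rule group_action.intro)
  have ME: "M \<in> ?E" using M(1) is_group by (rule subgroup.subgroup_in_rcosets)
  have finE: "finite ?E" using finite_carrier by (simp add: RCOSETS_def)
  have MM: "M #> inv g = M" if "g \<in> M" for g
    using coset_join2[OF _ M(1)] subgroup.m_inv_closed[OF M(1) that] MS by blast
  then have orbM: "orbit ?G ?\<phi> M = {M}"
    using ME subgroup.one_closed[OF M(1)] by (force simp: orbit_def)
  have pE: "p dvd card ?E"
  proof -
    obtain k where k: "card M = p ^ k" using card_subgroup_power[OF M(1)] by auto
    obtain n where n: "order S = p ^ n" using order_power by auto
    have lag: "card ?E * card M = order S" by (rule lagrange[OF M(1)])
    then have "card ?E dvd p ^ n" using n by (metis dvd_triv_left)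
    then obtain i where i: "card ?E = p ^ i" using prime by (auto simp: divides_primepow_nat)
    have "i \<noteq> 0"
    proof
      assume "i = 0"
      then have "card M = card (carrier S)" using lag i by (simp add: order_def)
      then show False
        using M card_subset_eq[OF finite_carrier subgroup.subset[OF M(1)]] by simp
    qed
    then show ?thesis using i by simp
  qed
  have "\<exists>R\<in>?E. R \<noteq> M \<and> orbit ?G ?\<phi> R = {R}"
  proof (rule ccontr)
    assume no: "\<not> ?thesis"
    have dv: "p dvd card O'" if O': "O' \<in> orbits ?G ?E ?\<phi>" "O' \<noteq> {M}" for O'
    proof -
      obtain R where R: "R \<in> ?E" "O' = orbit ?G ?\<phi> R" using O' by (auto simp: orbits_def)
      have RO: "R \<in> O'" using A.orbit_refl[OF R(1)] R(2) by simp
      have "R \<noteq> M" using R O'(2) orbM by auto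
      then have ne: "O' \<noteq> {R}" using no R by auto
      have "card O' * card (stabilizer ?G ?\<phi> R) = card M"
        using A.orbit_stabilizer_theorem[OF R(1)] R(2) by (simp add: order_def)
      moreover obtain k where k: "card M = p ^ k" using card_subgroup_power[OF M(1)] by auto
      ultimately have "card O' dvd p ^ k" by (metis dvd_triv_left)
      then obtain i where i: "card O' = p ^ i" using prime by (auto simp: divides_primepow_nat)
      have "i \<noteq> 0"
      proof
        assume "i = 0"
        then obtain r where "O' = {r}" using i by (metis card_1_singletonE power_0)
        then show False using RO ne by auto
      qed
      then show ?thesis using i by simp
    qed
    have Mo: "{M} \<in> orbits ?G ?E ?\<phi>" using ME orbM by (auto simp: orbits_def)
    have fo: "finite (orbits ?G ?E ?\<phi>)"
      using finE by (simp add: orbits_def setcompr_eq_image)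
    have "card ?E = (\<Sum>O'\<in>orbits ?G ?E ?\<phi>. card O')"
      using A.disjoint_sum[OF finE, of "\<lambda>_. 1::nat"] by simp
    also have "\<dots> = 1 + (\<Sum>O'\<in>orbits ?G ?E ?\<phi> - {{M}}. card O')"
      using sum.remove[OF fo Mo, of card] by simp
    finally have "p dvd 1 + (\<Sum>O'\<in>orbits ?G ?E ?\<phi> - {{M}}. card O')" using pE by simp
    moreover have "p dvd (\<Sum>O'\<in>orbits ?G ?E ?\<phi> - {{M}}. card O')"
      using dv by (intro dvd_sum) auto
    ultimately have "p dvd 1" by (metis dvd_add_left_iff)
    then show False using prime by simp
  qed
  then obtain R where R: "R \<in> ?E" "R \<noteq> M" "orbit ?G ?\<phi> R = {R}" by auto
  then obtain x where x: "x \<in> carrier S" "R = M #> x" by (auto simp: RCOSETS_def)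
  have "x \<notin> M" using x R(2) coset_join2[OF x(1) M(1)] by auto
  moreover have "x \<otimes> g \<otimes> inv x \<in> M" if g: "g \<in> M" for g
  proof -
    have ig: "inv g \<in> M" using g M(1) by (simp add: subgroup.m_inv_closed)
    have "?\<phi> (inv g) R \<in> orbit ?G ?\<phi> R" using ig by (auto simp: orbit_def)
    then have "R #> g = R" using R(1,3) MS[OF g] by auto
    then have "M #> (x \<otimes> g) = M #> x"
      using x MS[OF g] subgroup.subset[OF M(1)] by (simp add: coset_mult_assoc)
    then have "x \<otimes> g \<in> M #> x"
      using rcos_self[OF _ M(1), of "x \<otimes> g"] x MS[OF g] by auto
    then obtain m where "m \<in> M" "x \<otimes> g = m \<otimes> x" by (auto simp: r_coset_def)
    then show ?thesis using x MS g by (simp add: m_assoc)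
  qed
  ultimately show thesis using that x(1) by blast
qed

lemma maximal_subgroup_eq_carrier:
  assumes "maximal_subgroup M S" "subgroup H S" "M \<subseteq> H" "x \<in> H" "x \<notin> M"
  shows "H = carrier S"
  using assms unfolding maximal_subgroup_def by blast

lemma maximal_subgroup_normal:
  assumes M: "maximal_subgroup M S"
  shows "M \<lhd> S"
proof -
  have sM: "subgroup M S" "M \<noteq> carrier S"
    and mx: "\<And>H. subgroup H S \<Longrightarrow> M \<subseteq> H \<Longrightarrow> H = M \<or> H = carrier S"
    using M by (auto simp: maximal_subgroup_def)
  obtain x where x: "x \<in> carrier S" "x \<notin> M" "\<And>g. g \<in> M \<Longrightarrow> x \<otimes> g \<otimes> inv x \<in> M"
    using maximal_subgroup_normalizing_element[OF sM] by blast
  let ?K = "{y \<in> carrier S. \<forall>g\<in>M. y \<otimes> g \<otimes> inv y \<in> M}"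
  have MS: "g \<in> carrier S" if "g \<in> M" for g using sM(1) that by (rule subgroup.mem_carrier)
  have MK: "M \<subseteq> ?K" using sM(1) MS by (auto simp: subgroup.m_closed subgroup.m_inv_closed)
  have "subgroup ?K S"
    by (rule finite_subgroupI[OF finite_carrier])
      (use MK MS subgroup.one_closed[OF sM(1)] in \<open>auto simp: mult_conj\<close>)
  then have "?K = carrier S" using mx[of ?K] MK x by auto
  then show ?thesis using sM(1) by (auto simp: normal_inv_iff)
qed

lemma maximal_subgroup_adjoin:
  assumes M: "maximal_subgroup M S" and y: "y \<in> carrier S" "y \<notin> M" and x: "x \<in> carrier S"
  obtains m k where "m \<in> M" "x = m \<otimes> y [^] (k::int)"
proof -
  interpret M: normal M S using M by (rule maximal_subgroup_normal)
  let ?L = "{h \<otimes> y [^] (k::int) | h k. h \<in> M}"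
  have "subgroup ?L S"
    using y M.inv_op_closed1 M.inv_op_closed2 by (intro subgroup_adjoin) (auto intro: M.subgroup_axioms)
  then have "?L = carrier S"
    by (rule maximal_subgroup_eq_carrier[OF M _ _ _ y(2)]) (rule mem_adjoin[OF M.subgroup_axioms y(1)])+
  then have "x \<in> ?L" using x by simp
  then show thesis using that by (elim CollectE exE conjE)
qed

text \<open>The exponent k is invertible modulo the order of \<open>S\<close>, a power of p, so
  \<open>x\<close> is itself a power of x^k.\<close>

lemma int_pow_coprime_mem:
  assumes H: "subgroup H S" and x: "x \<in> carrier S" and k: "\<not> int p dvd k" "x [^] (k::int) \<in> H"
  shows "x \<in> H"
proof -
  obtain n where n: "order S = p ^ n" using order_power by auto
  have "Factorial_Ring.prime (int p)" using prime by simp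
  then have "coprime (int p) k" using k(1) by (rule prime_imp_coprime)
  then have "coprime k (int p ^ n)" by (metis coprime_commute coprime_power_right_iff)
  then obtain a b where ab: "a * k + b * int p ^ n = 1"
    using bezout_int[of k "int p ^ n"] by (auto simp: coprime_iff_gcd_eq_1)
  have "x = x [^] (k * a + int (p ^ n) * b)" using ab x by (simp add: mult.commute)
  also have "\<dots> = (x [^] k) [^] a \<otimes> (x [^] order S) [^] b"
    using x n by (simp only: int_pow_mult int_pow_pow[symmetric] int_pow_int)
  also have "\<dots> = (x [^] k) [^] a" using x pow_order_eq_1[OF x] by simp
  finally show ?thesis using subgroup_int_pow_closed[OF H k(2)] by metis
qed

text \<open>If x^p were outside \<open>M\<close>, then \<open>M\<close> and x^p would generate
  \<open>S\<close>, so that x = m (x^p)^k and x^(1 - pk) lies in \<open>M\<close>. The exponent 1 -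
  pk is prime to p, which puts \<open>x\<close> into \<open>M\<close>, and x^p with it.\<close>

lemma maximal_subgroup_pow_p:
  assumes M: "maximal_subgroup M S" and x: "x \<in> carrier S"
  shows "x [^] p \<in> M"
proof (rule ccontr)
  assume a: "x [^] p \<notin> M"
  have sM: "subgroup M S" using M by (simp add: maximal_subgroup_def)
  obtain m k where m: "m \<in> M" "x = m \<otimes> (x [^] p) [^] (k::int)"
    using maximal_subgroup_adjoin[OF M _ a x] x by auto
  have mS: "m \<in> carrier S" using sM m(1) by (rule subgroup.mem_carrier)
  have "x [^] (1 - int p * k) = x \<otimes> inv ((x [^] p) [^] k)"
    using x by (simp add: int_pow_diff int_pow_pow[symmetric] int_pow_int)
  also have "\<dots> = m" using m(2) x mS by (metis inv_solve_right int_pow_closed nat_pow_closed)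
  finally have "x [^] (1 - int p * k) \<in> M" using m by simp
  moreover have "\<not> int p dvd 1 - int p * k"
  proof
    assume "int p dvd 1 - int p * k"
    then have "int p dvd (1 - int p * k) + int p * k" by (rule dvd_add) simp
    then show False using prime by simp
  qed
  ultimately have "x \<in> M" using int_pow_coprime_mem[OF sM x] by blast
  then show False using a subgroup_int_pow_closed[OF sM, of x "int p"] by (simp add: int_pow_int)
qed

end

subsection \<open>Groups with two abelian maximal subgroups\<close>

definition center :: "('a, 'b) monoid_scheme \<Rightarrow> 'a set" where
  "center G = {z \<in> carrier G. \<forall>x \<in> carrier G. z \<otimes>\<^bsub>G\<^esub> x = x \<otimes>\<^bsub>G\<^esub> z}"

definition centralizer :: "('a, 'b) monoid_scheme \<Rightarrow> 'a \<Rightarrow> 'a set" where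
  "centralizer G x = {y \<in> carrier G. y \<otimes>\<^bsub>G\<^esub> x = x \<otimes>\<^bsub>G\<^esub> y}"

definition commutator :: "('a, 'b) monoid_scheme \<Rightarrow> 'a \<Rightarrow> 'a \<Rightarrow> 'a" where
  "commutator G x y = x \<otimes>\<^bsub>G\<^esub> y \<otimes>\<^bsub>G\<^esub> inv\<^bsub>G\<^esub> x \<otimes>\<^bsub>G\<^esub> inv\<^bsub>G\<^esub> y"

context group
begin

lemma subgroup_centralizer:
  assumes "x \<in> carrier G"
  shows "subgroup (centralizer G x) G"
proof (rule subgroupI)
  fix a assume "a \<in> centralizer G x"
  then have "a \<in> carrier G" "a \<otimes> x = x \<otimes> a" by (auto simp: centralizer_def)
  then have "inv a \<otimes> x = x \<otimes> inv a"
    using assms by (metis inv_closed inv_solve_left inv_solve_right m_assoc m_closed)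
  then show "inv a \<in> centralizer G x" using \<open>a \<in> carrier G\<close> by (simp add: centralizer_def)
next
  fix a b assume "a \<in> centralizer G x" "b \<in> centralizer G x"
  then show "a \<otimes> b \<in> centralizer G x" using assms by (auto simp: centralizer_def) (metis m_assoc)
qed (use assms in \<open>auto simp: centralizer_def intro!: exI[of _ \<one>]\<close>)

lemma center_eq_Inter: "center G = carrier G \<inter> (\<Inter>x\<in>carrier G. centralizer G x)"
  by (auto simp: center_def centralizer_def)

lemma subgroup_center: "subgroup (center G) G"
proof -
  have "center G = (\<Inter>x\<in>carrier G. centralizer G x)"
    unfolding center_eq_Inter using subgroup.subset[OF subgroup_centralizer] one_closed by blast
  moreover have "subgroup (\<Inter>((\<lambda>x. centralizer G x) ` carrier G)) G"
    by (rule subgroups_Inter) (use subgroup_centralizer in auto)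
  ultimately show ?thesis by simp
qed

lemma centralizer_eq_carrier_imp_center:
  assumes "centralizer G x = carrier G" "x \<in> carrier G"
  shows "x \<in> center G"
  unfolding center_def
proof (intro CollectI conjI ballI assms(2))
  fix y assume "y \<in> carrier G"
  then have "y \<in> centralizer G x" using assms(1) by simp
  then show "x \<otimes> y = y \<otimes> x" unfolding centralizer_def by simp
qed

lemma center_closed [simp]: "z \<in> center G \<Longrightarrow> z \<in> carrier G"
  by (simp add: center_def)

lemma center_commute: "z \<in> center G \<Longrightarrow> x \<in> carrier G \<Longrightarrow> z \<otimes> x = x \<otimes> z"
  unfolding center_def by blast

lemma center_conj: "z \<in> center G \<Longrightarrow> x \<in> carrier G \<Longrightarrow> x \<otimes> z \<otimes> inv x = z"
  using center_commute[of z x] by (subst conj_fixes_iff_commute) auto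

lemma commutator_closed [simp]:
  "x \<in> carrier G \<Longrightarrow> y \<in> carrier G \<Longrightarrow> commutator G x y \<in> carrier G"
  by (simp add: commutator_def)

lemma conj_eq_commutator_mult:
  "x \<in> carrier G \<Longrightarrow> y \<in> carrier G \<Longrightarrow> x \<otimes> y \<otimes> inv x = commutator G x y \<otimes> y"
  by (simp add: commutator_def m_assoc)

lemma inv_commutator:
  "x \<in> carrier G \<Longrightarrow> y \<in> carrier G \<Longrightarrow> inv (commutator G x y) = commutator G y x"
  by (simp add: commutator_def m_assoc inv_mult_group)

lemma commutator_eq_one_iff:
  assumes "x \<in> carrier G" "y \<in> carrier G"
  shows "commutator G x y = \<one> \<longleftrightarrow> x \<otimes> y = y \<otimes> x"
  using assms conj_fixes_iff_commute[of x y] conj_eq_commutator_mult[of x y]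
  by (metis commutator_closed l_one m_closed one_closed r_cancel_one)

lemma commutator_mult_right:
  assumes "x \<in> carrier G" "y \<in> carrier G" "y' \<in> carrier G" "commutator G x y' \<in> center G"
  shows "commutator G x (y \<otimes> y') = commutator G x y \<otimes> commutator G x y'"
proof -
  have "x \<otimes> (y \<otimes> y') \<otimes> inv x = (commutator G x y \<otimes> y) \<otimes> (commutator G x y' \<otimes> y')"
    using assms by (simp add: conj_mult flip: conj_eq_commutator_mult)
  also have "\<dots> = commutator G x y \<otimes> (y \<otimes> commutator G x y') \<otimes> y'"
    using assms by (simp add: m_assoc)
  also have "y \<otimes> commutator G x y' = commutator G x y' \<otimes> y"
    using center_commute[OF assms(4,2)] by simp
  finally have "x \<otimes> (y \<otimes> y') \<otimes> inv x = (commutator G x y \<otimes> commutator G x y') \<otimes> (y \<otimes> y')"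
    using assms by (simp add: m_assoc)
  then have "commutator G x (y \<otimes> y') \<otimes> (y \<otimes> y') = (commutator G x y \<otimes> commutator G x y') \<otimes> (y \<otimes> y')"
    using assms by (simp flip: conj_eq_commutator_mult)
  then show ?thesis using assms by (simp only: r_cancel commutator_closed m_closed)
qed

lemma commutator_pow_right:
  assumes "x \<in> carrier G" "y \<in> carrier G" "commutator G x y \<in> center G"
  shows "commutator G x (y [^] (n::nat)) = commutator G x y [^] n"
proof (induction n)
  case 0
  then show ?case using assms by (simp add: commutator_def)
next
  case (Suc n)
  then show ?case using commutator_mult_right[OF assms(1) _ assms(2,3), of "y [^] n"] assms by simp
qed

end

locale two_abelian_maximals = finite_p_group p S for p :: nat and S (structure) +
  fixes M N
  assumes MN: "M \<noteq> N"
    and max_M: "maximal_subgroup M S" and comm_M: "comm_group (S\<lparr>carrier := M\<rparr>)"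
    and max_N: "maximal_subgroup N S" and comm_N: "comm_group (S\<lparr>carrier := N\<rparr>)"
begin

lemma abelian_commute:
  assumes "comm_group (S\<lparr>carrier := A\<rparr>)" "x \<in> A" "y \<in> A"
  shows "x \<otimes> y = y \<otimes> x"
  using comm_monoid.m_comm[OF comm_group.axioms(1)[OF assms(1)], of x y] assms by simp

lemma swapped: "two_abelian_maximals p S N M"
  using two_abelian_maximals.intro[OF finite_p_group_axioms
    two_abelian_maximals_axioms.intro[OF MN[symmetric] max_N comm_N max_M comm_M]] .

lemma maximal_imp_subgroup: "maximal_subgroup A S \<Longrightarrow> subgroup A S"
  unfolding maximal_subgroup_def by (elim conjE)

lemma maximal_closed: "maximal_subgroup A S \<Longrightarrow> x \<in> A \<Longrightarrow> x \<in> carrier S"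
  using subgroup.mem_carrier[OF maximal_imp_subgroup] .

lemma ex_diff: "\<exists>a. a \<in> M \<and> a \<notin> N"
proof (rule ccontr)
  assume "\<nexists>a. a \<in> M \<and> a \<notin> N"
  then have "M \<subseteq> N" by auto
  then show False using MN max_M max_N unfolding maximal_subgroup_def by metis
qed

text \<open>The centralizer of \<open>y\<close> contains the abelian group \<open>A\<close> and the
  outside element \<open>h\<close>, so maximality of \<open>A\<close> makes it all of
  \<open>S\<close>. This is the standard way below to prove an element central.\<close>

lemma abelian_maximal_central:
  assumes A: "maximal_subgroup A S" "comm_group (S\<lparr>carrier := A\<rparr>)"
    and y: "y \<in> A" and h: "h \<in> carrier S" "h \<notin> A" "h \<otimes> y = y \<otimes> h"
  shows "y \<in> center S"
proof -
  have yS: "y \<in> carrier S" using maximal_closed[OF A(1) y] .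
  have "centralizer S y = carrier S"
  proof (rule maximal_subgroup_eq_carrier[OF A(1) subgroup_centralizer[OF yS] _ _ h(2)])
    show "A \<subseteq> centralizer S y"
      using abelian_commute[OF A(2) _ y] maximal_closed[OF A(1)] by (auto simp: centralizer_def)
    show "h \<in> centralizer S y" using h by (simp add: centralizer_def)
  qed
  then show ?thesis using yS by (rule centralizer_eq_carrier_imp_center)
qed

lemma Int_central:
  assumes "z \<in> M" "z \<in> N"
  shows "z \<in> center S"
proof -
  obtain g where g: "g \<in> N" "g \<notin> M" using two_abelian_maximals.ex_diff[OF swapped] by auto
  show ?thesis
    using abelian_maximal_central[OF max_M comm_M assms(1) _ g(2)]
      abelian_commute[OF comm_N g(1) assms(2)] maximal_closed[OF max_N g(1)] by auto
qed

lemma pow_p_central: "x \<in> carrier S \<Longrightarrow> x [^] p \<in> center S"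
  using Int_central maximal_subgroup_pow_p max_M max_N by blast

text \<open>From S = N<m> and m in \<open>M\<close> it follows that M = (M \<inter> N)<m>, so
  \<open>L\<close> contains \<open>M\<close>; it also contains \<open>x\<close>, which lies outside
  \<open>M\<close>.\<close>

lemma subgroup_eq_carrier:
  assumes L: "subgroup L S" "M \<inter> N \<subseteq> L" and x: "x \<in> L" "x \<notin> M" and m: "m \<in> L" "m \<in> M" "m \<notin> N"
  shows "L = carrier S"
proof (rule maximal_subgroup_eq_carrier[OF max_M L(1) _ x])
  show "M \<subseteq> L"
  proof
    fix y assume y: "y \<in> M"
    obtain n k where n: "n \<in> N" "y = n \<otimes> m [^] (k::int)"
      using maximal_subgroup_adjoin[OF max_N maximal_closed[OF max_M m(2)] m(3) maximal_closed[OF max_M y]]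
      by blast
    have mk: "m [^] k \<in> M" "m [^] k \<in> L"
      using subgroup_int_pow_closed m L(1) maximal_imp_subgroup[OF max_M] by blast+
    have "n = y \<otimes> inv (m [^] k)"
      using n mk(1) maximal_closed max_M max_N y by (simp add: inv_solve_right)
    then have "n \<in> M"
      using y mk(1) maximal_imp_subgroup[OF max_M] by (simp add: subgroup.m_closed subgroup.m_inv_closed)
    then show "y \<in> L" using n L mk(2) subgroup.m_closed[OF L(1)] by blast
  qed
qed

text \<open>A subgroup that contains \<open>x\<close>, the center and an element of \<open>M\<close>
  outside \<open>N\<close> is already \<open>S\<close>. Hence the centralizer of \<open>x\<close>
  meets \<open>M\<close> only inside \<open>N\<close>, that is, in central elements, and so equals
  Z(S)<x>, which is abelian; any larger subgroup acquires an element of \<open>M\<close> outside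
  \<open>N\<close>. The condition \<open>x \<notin> M\<close> is removed afterwards by exchanging
  \<open>M\<close> and \<open>N\<close>, because a noncentral element cannot lie in both.\<close>

lemma centralizer_maximal_aux:
  assumes x: "x \<in> carrier S" "x \<notin> center S" "x \<notin> M"
  shows "maximal_subgroup (centralizer S x) S \<and> comm_group (S\<lparr>carrier := centralizer S x\<rparr>)"
proof
  let ?C = "centralizer S x"
  have C: "subgroup ?C S" using x(1) by (rule subgroup_centralizer)
  have xC: "x \<in> ?C" using x by (simp add: centralizer_def)
  have ne: "?C \<noteq> carrier S" using centralizer_eq_carrier_imp_center[of x] x by auto
  have IntC: "center S \<subseteq> ?C"
  proof
    fix z assume z: "z \<in> center S"
    then show "z \<in> ?C" using center_commute[OF z x(1)] by (simp add: centralizer_def)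
  qed
  \<comment> \<open>Dedekind's modular law: since S = M<x> and x is in \<open>L\<close>, one has L =
    (M \<inter> L)<x>.\<close>
  have split: "\<exists>m k. m \<in> M \<and> m \<in> L \<and> y = m \<otimes> x [^] (k::int)"
    if L: "subgroup L S" "x \<in> L" "y \<in> L" for L y
  proof -
    have yS: "y \<in> carrier S" using L by (auto intro: subgroup.mem_carrier)
    obtain m k where m: "m \<in> M" "y = m \<otimes> x [^] (k::int)"
      using maximal_subgroup_adjoin[OF max_M x(1,3) yS] by blast
    have "m = y \<otimes> inv (x [^] k)" using m x yS maximal_closed[OF max_M] by (simp add: inv_solve_right)
    then have "m \<in> L"
      using subgroup.m_closed[OF L(1,3) subgroup.m_inv_closed[OF L(1) subgroup_int_pow_closed[OF L(1,2)]]]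
      by simp
    then show ?thesis using m by blast
  qed
  show "maximal_subgroup ?C S"
    unfolding maximal_subgroup_def
  proof (intro conjI allI impI C ne)
    fix L assume L: "subgroup L S" "?C \<subseteq> L"
    show "L = ?C \<or> L = carrier S"
    proof (cases "L = ?C")
      case False
      then obtain y where y: "y \<in> L" "y \<notin> ?C" using L by blast
      obtain m k where m: "m \<in> M" "m \<in> L" "y = m \<otimes> x [^] (k::int)"
        using split[OF L(1) _ y(1)] xC L(2) by blast
      have "m \<notin> N"
      proof
        assume "m \<in> N"
        then have "m \<in> ?C" using Int_central m(1) IntC by blast
        then show False
          using y m(3) subgroup.m_closed[OF C _ subgroup_int_pow_closed[OF C xC]] by blast
      qed
      then show ?thesis
        using subgroup_eq_carrier[OF L(1) _ _ x(3) m(2,1)] xC L(2) IntC Int_central by blast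
    qed simp
  qed
  have form: "\<exists>z k. z \<in> center S \<and> y = z \<otimes> x [^] (k::int)" if y: "y \<in> ?C" for y
  proof -
    obtain m k where m: "m \<in> M" "m \<in> ?C" "y = m \<otimes> x [^] (k::int)" using split[OF C xC y] by blast
    have "m \<in> N"
      using subgroup_eq_carrier[OF C _ xC x(3) m(2,1)] IntC Int_central ne by blast
    then show ?thesis using m Int_central by blast
  qed
  have "y \<otimes> y' = y' \<otimes> y" if y: "y \<in> ?C" "y' \<in> ?C" for y y'
  proof -
    obtain z k where z: "z \<in> center S" "y = z \<otimes> x [^] (k::int)" using form[OF y(1)] by blast
    have y'S: "y' \<in> carrier S" using y(2) by (simp add: centralizer_def)
    have "x \<in> centralizer S y'" using y(2) x(1) by (simp add: centralizer_def)
    then have "x [^] k \<in> centralizer S y'" by (rule subgroup_int_pow_closed[OF subgroup_centralizer[OF y'S]])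
    moreover have "z \<in> centralizer S y'" using z y'S center_commute[OF z(1) y'S] by (simp add: centralizer_def)
    ultimately have "y \<in> centralizer S y'"
      using subgroup.m_closed[OF subgroup_centralizer[OF y'S]] z by blast
    then show ?thesis by (simp add: centralizer_def)
  qed
  then show "comm_group (S\<lparr>carrier := ?C\<rparr>)"
    using subgroup.subgroup_is_group[OF C is_group]
    by (intro group.group_comm_groupI) auto
qed

lemma centralizer_maximal:
  assumes "x \<in> carrier S" "x \<notin> center S"
  shows "maximal_subgroup (centralizer S x) S" "comm_group (S\<lparr>carrier := centralizer S x\<rparr>)"
  using centralizer_maximal_aux[OF assms] two_abelian_maximals.centralizer_maximal_aux[OF swapped assms]
    Int_central assms(2) by blast+

lemma center_le_abelian_maximal:
  assumes A: "maximal_subgroup A S" "comm_group (S\<lparr>carrier := A\<rparr>)" and ne: "center S \<noteq> carrier S"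
  shows "center S \<subseteq> A"
proof (rule subsetI, rule ccontr)
  fix z assume z: "z \<in> center S" "z \<notin> A"
  then have AZ: "A \<subseteq> center S"
    using abelian_maximal_central[OF A _ _ z(2)] center_commute[OF z(1)] maximal_closed[OF A(1)] by auto
  have "center S = carrier S"
    by (rule maximal_subgroup_eq_carrier[OF A(1) subgroup_center AZ z])
  then show False using ne by simp
qed

text \<open>Take d = [g, a] with g in N - M and a in M - N; by normality d lies in both
  \<open>M\<close> and \<open>N\<close>, so it is central. For fixed x the elements y with [x, y] in
  <d> form a subgroup containing M \<inter> N, so testing y = a and y = g decides for all of
  \<open>S\<close>. This is done for x = g, for x = a, and then for arbitrary x. Finally d^p =
  [g, a^p] = 1, as a^p is central.\<close>

lemma derived_cyclic:
  obtains d where "d \<in> center S" "d [^] p = \<one>" "derived S (carrier S) = range (\<lambda>k::int. d [^] k)"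
proof -
  obtain a where a: "a \<in> M" "a \<notin> N" using ex_diff by auto
  obtain g where g: "g \<in> N" "g \<notin> M" using two_abelian_maximals.ex_diff[OF swapped] by auto
  have aS: "a \<in> carrier S" and gS: "g \<in> carrier S"
    using a g maximal_closed max_M max_N by auto
  interpret NM: normal M S using max_M by (rule maximal_subgroup_normal)
  interpret NN: normal N S using max_N by (rule maximal_subgroup_normal)
  define d where "d = commutator S g a"
  have "d \<in> M"
    using NM.inv_op_closed2[OF gS a(1)] a(1) NM.m_closed NM.m_inv_closed
    unfolding d_def commutator_def by blast
  moreover have "d = g \<otimes> (a \<otimes> inv g \<otimes> inv a)"
    using aS gS by (simp add: d_def commutator_def m_assoc)
  then have "d \<in> N"
    using NN.inv_op_closed2[OF aS, of "inv g"] g(1) NN.m_closed NN.m_inv_closed by simp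
  ultimately have dZ: "d \<in> center S" by (rule Int_central)
  let ?D = "generate S {d}"
  have dS: "d \<in> carrier S" using dZ by simp
  have D: "subgroup ?D S" using generate_is_subgroup[of "{d}"] dS by simp
  have D_eq: "?D = range (\<lambda>k::int. d [^] k)" using generate_pow[OF dS] by auto
  have dD: "d \<in> ?D" by (simp add: generate.incl)
  have DZ: "?D \<subseteq> center S"
    using generate_subgroup_incl[OF _ subgroup_center, of "{d}"] dZ by simp
  have sub: "subgroup {y \<in> carrier S. commutator S x y \<in> ?D} S" if x: "x \<in> carrier S" for x
  proof (rule finite_subgroupI[OF finite_carrier])
    show "{y \<in> carrier S. commutator S x y \<in> ?D} \<noteq> {}"
      using x subgroup.one_closed[OF D] by (auto intro!: exI[of _ \<one>] simp: commutator_def)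
  next
    fix y y' assume "y \<in> {y \<in> carrier S. commutator S x y \<in> ?D}" "y' \<in> {y \<in> carrier S. commutator S x y \<in> ?D}"
    then show "y \<otimes> y' \<in> {y \<in> carrier S. commutator S x y \<in> ?D}"
      using x commutator_mult_right[of x y y'] DZ subgroup.m_closed[OF D] by auto
  qed auto
  have all: "commutator S x y \<in> ?D"
    if x: "x \<in> carrier S" "commutator S x a \<in> ?D" "commutator S x g \<in> ?D" and y: "y \<in> carrier S" for x y
  proof -
    have "{y \<in> carrier S. commutator S x y \<in> ?D} = carrier S"
    proof (rule subgroup_eq_carrier[OF sub[OF x(1)] _ _ g(2) _ a])
      have "commutator S x y = \<one>" if "y \<in> center S" for y
        using that x center_commute[OF that x(1)] by (simp add: commutator_eq_one_iff)
      then show "M \<inter> N \<subseteq> {y \<in> carrier S. commutator S x y \<in> ?D}"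
        using Int_central subgroup.one_closed[OF D] by auto
    qed (use x aS gS in auto)
    then show ?thesis using y by auto
  qed
  have swp: "commutator S y x \<in> ?D" if "x \<in> carrier S" "y \<in> carrier S" "commutator S x y \<in> ?D" for x y
    using subgroup.m_inv_closed[OF D that(3)] that by (simp add: inv_commutator)
  have oneD: "commutator S x x \<in> ?D" if "x \<in> carrier S" for x
    using commutator_eq_one_iff[OF that that] subgroup.one_closed[OF D] by simp
  have ga: "commutator S g a \<in> ?D" using dD by (simp add: d_def)
  have "commutator S g y \<in> ?D" if "y \<in> carrier S" for y
    using all[OF gS ga oneD[OF gS] that] .
  moreover have "commutator S a y \<in> ?D" if "y \<in> carrier S" for y
    using all[OF aS oneD[OF aS] swp[OF gS aS ga] that] .
  ultimately have comD: "commutator S x y \<in> ?D" if "x \<in> carrier S" "y \<in> carrier S" for x y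
    using all[OF that(1) _ _ that(2)] swp aS gS that by blast
  have "derived S (carrier S) \<subseteq> ?D"
    unfolding derived_def
    by (rule generate_subgroup_incl[OF _ D]) (use comD in \<open>auto simp: commutator_def\<close>)
  moreover have "?D \<subseteq> derived S (carrier S)"
    unfolding derived_def
    by (rule mono_generate) (use aS gS in \<open>auto simp: d_def commutator_def\<close>)
  ultimately have "derived S (carrier S) = range (\<lambda>k::int. d [^] k)" using D_eq by simp
  moreover have "d [^] p = \<one>"
  proof -
    have "d [^] p = commutator S g (a [^] p)"
      using commutator_pow_right[OF gS aS] dZ unfolding d_def by simp
    also have "\<dots> = \<one>"
      using center_commute[OF pow_p_central[OF aS] gS] aS gS by (simp add: commutator_eq_one_iff)
    finally show ?thesis .
  qed
  ultimately show thesis using that dZ by blast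
qed

abbreviation "D \<equiv> derived S (carrier S)"

lemma subgroup_derived: "subgroup D S"
  using derived_is_subgroup[of "carrier S"] by simp

lemma derived_central: "D \<subseteq> center S"
  using derived_cyclic subgroup_int_pow_closed[OF subgroup_center] by (metis image_subset_iff)

lemma commutator_derived: "x \<in> carrier S \<Longrightarrow> y \<in> carrier S \<Longrightarrow> commutator S x y \<in> D"
  unfolding derived_def commutator_def by (rule generate.incl) blast

lemma commutator_central: "x \<in> carrier S \<Longrightarrow> y \<in> carrier S \<Longrightarrow> commutator S x y \<in> center S"
  using commutator_derived derived_central by blast

lemma derived_pow_p:
  assumes "s \<in> D"
  shows "s [^] p = \<one>"
proof -
  obtain d where d: "d \<in> center S" "d [^] p = \<one>" "D = range (\<lambda>k::int. d [^] k)" by (rule derived_cyclic)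
  then obtain k where s: "s = d [^] (k::int)" using assms by auto
  have "s [^] p = (d [^] p) [^] k"
    using d(1) by (simp add: s int_pow_pow mult.commute flip: int_pow_int)
  then show ?thesis using d by simp
qed

lemma derived_generator:
  assumes s: "s \<in> D" "s \<noteq> \<one>" and e: "e \<in> D"
  shows "\<exists>k::int. e = s [^] k"
proof -
  obtain d where d: "d \<in> center S" "d [^] p = \<one>" "D = range (\<lambda>k::int. d [^] k)" by (rule derived_cyclic)
  then obtain k where k: "s = d [^] (k::int)" using s by auto
  have dS: "d \<in> carrier S" using d by simp
  have "\<not> int p dvd k"
  proof
    assume "int p dvd k"
    then obtain j where "k = int p * j" by auto
    then have "s = (d [^] p) [^] j" using k dS by (simp add: int_pow_pow flip: int_pow_int)
    then show False using d s by simp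
  qed
  moreover have sg: "subgroup (generate S {s}) S"
    using generate_is_subgroup[of "{s}"] k dS by simp
  moreover have "d [^] k \<in> generate S {s}" using k by (simp add: generate.incl)
  ultimately have "d \<in> generate S {s}" using int_pow_coprime_mem[OF _ dS] by blast
  moreover obtain j where "e = d [^] (j::int)" using e d by auto
  ultimately have "e \<in> generate S {s}" using subgroup_int_pow_closed[OF sg] by blast
  then show ?thesis using generate_pow[of s] k dS by auto
qed

end

lemma (in group) mem_normalizer_normal: "N \<lhd> G \<Longrightarrow> normalizer G N = carrier G"
proof -
  assume N: "N \<lhd> G"
  interpret normal N G by fact
  have "g <# N #> inv g = N" if "g \<in> carrier G" for g
    using coset_eq that subset by (simp add: coset_mult_assoc flip: coset_eq)
  then show ?thesis using subset unfolding normalizer_def stabilizer_def by auto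
qed

section \<open>Maximality is determined by the order of a subgroup\<close>

context finite_p_group
begin

text \<open>For \<open>y\<close> outside \<open>M\<close> every element is in M y^k, and y^p in
  \<open>M\<close> reduces k modulo p, so at most p cosets occur.\<close>

lemma card_maximal_subgroup_le:
  assumes M: "maximal_subgroup M S"
  shows "order S \<le> p * card M"
proof -
  have sM: "subgroup M S" "M \<noteq> carrier S" using M by (auto simp: maximal_subgroup_def)
  then obtain y where y: "y \<in> carrier S" "y \<notin> M" using subgroup.subset by blast
  have pp: "p > 0" using prime prime_gt_0_nat by blast
  have "carrier S \<subseteq> (\<lambda>(m, k). m \<otimes> y [^] (k::nat)) ` (M \<times> {..<p})"
  proof
    fix x assume x: "x \<in> carrier S"
    obtain m k where m: "m \<in> M" "x = m \<otimes> y [^] (k::int)"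
      using maximal_subgroup_adjoin[OF M y x] by blast
    have "(y [^] p) [^] (k div int p) \<in> M"
      using subgroup_int_pow_closed[OF sM(1) maximal_subgroup_pow_p[OF M y(1)]] .
    moreover have "y [^] (int p * (k div int p)) = (y [^] p) [^] (k div int p)"
      using y(1) by (simp add: int_pow_pow flip: int_pow_int)
    moreover have "y [^] (k mod int p) = y [^] nat (k mod int p)"
      using int_pow_int[of S y "nat (k mod int p)"] pp by simp
    ultimately have "(y [^] p) [^] (k div int p) \<in> M"
      "y [^] k = (y [^] p) [^] (k div int p) \<otimes> y [^] nat (k mod int p)"
      using int_pow_mult[OF y(1), of "int p * (k div int p)" "k mod int p"] by simp_all
    then have "x = (m \<otimes> (y [^] p) [^] (k div int p)) \<otimes> y [^] nat (k mod int p)"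
      "m \<otimes> (y [^] p) [^] (k div int p) \<in> M"
      using m y subgroup.mem_carrier[OF sM(1) m(1)] subgroup.m_closed[OF sM(1) m(1)]
      by (auto simp: m_assoc)
    moreover have "nat (k mod int p) < p" using pp by (simp add: nat_less_iff)
    ultimately show "x \<in> (\<lambda>(m, k). m \<otimes> y [^] (k::nat)) ` (M \<times> {..<p})" by force
  qed
  then have "order S \<le> card ((\<lambda>(m, k). m \<otimes> y [^] (k::nat)) ` (M \<times> {..<p}))"
    unfolding order_def using finite_subgroup[OF sM(1)] by (intro card_mono) auto
  also have "\<dots> \<le> card (M \<times> {..<p})" using finite_subgroup[OF sM(1)] by (intro card_image_le) auto
  finally show ?thesis by (simp add: card_cartesian_product mult.commute)
qed

lemma card_psubset_subgroup:
  assumes H: "subgroup H S" and K: "subgroup K S" and HK: "H \<subset> K"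
  shows "p * card H \<le> card K"
proof -
  obtain i where i: "card H = p ^ i" using card_subgroup_power[OF H] by auto
  obtain j where j: "card K = p ^ j" using card_subgroup_power[OF K] by auto
  have p1: "p > 1" using prime prime_gt_1_nat by blast
  have "card H < card K" using psubset_card_mono[OF finite_subgroup[OF K] HK] .
  then have "i < j" using i j p1 by simp
  then have "p ^ Suc i \<le> p ^ j" using p1 by (intro power_increasing) auto
  then show ?thesis using i j by simp
qed

text \<open>A subgroup strictly between \<open>L\<close> and \<open>S\<close> would force the order
  of \<open>S\<close> to be at least p^2 times that of \<open>L\<close>, against index at most p.
  This carries maximality along fusion isomorphisms, which preserve only the order.\<close>

lemma maximal_subgroup_card:
  assumes M: "maximal_subgroup M S" and L: "subgroup L S" and c: "card L = card M"
  shows "maximal_subgroup L S"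
proof -
  have sM: "subgroup M S" "M \<noteq> carrier S" using M by (auto simp: maximal_subgroup_def)
  have p1: "p > 1" using prime prime_gt_1_nat by blast
  have "card M < order S"
    unfolding order_def using psubset_card_mono[OF finite_carrier] subgroup.subset[OF sM(1)] sM(2) by blast
  then have ne: "L \<noteq> carrier S" using c by (auto simp: order_def)
  show ?thesis
    unfolding maximal_subgroup_def
  proof (intro conjI L ne allI impI, rule ccontr)
    fix H assume H: "subgroup H S" "L \<subseteq> H" "\<not> (H = L \<or> H = carrier S)"
    have "p * card L \<le> card H" by (rule card_psubset_subgroup[OF L H(1)]) (use H in auto)
    moreover have "p * card H \<le> card (carrier S)"
      by (rule card_psubset_subgroup[OF H(1) subgroup_self]) (use H subgroup.subset[OF H(1)] in auto)
    moreover have "order S \<le> p * card L" using card_maximal_subgroup_le[OF M] c by simp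
    ultimately have "p * card H \<le> card H" unfolding order_def by linarith
    moreover have "card H > 0" using subgroup.finite_imp_card_positive[OF H(1) finite_carrier] .
    ultimately show False using p1 by simp
  qed
qed

end

subsection \<open>Morphisms and automorphism groups of a fusion system\<close>

abbreviation aut_group :: "('a, 'b) monoid_scheme \<Rightarrow> ('a set \<Rightarrow> 'a set \<Rightarrow> ('a \<Rightarrow> 'a) set) \<Rightarrow> 'a set \<Rightarrow> ('a \<Rightarrow> 'a) monoid"
  where "aut_group S F A \<equiv> AutoGroup (S\<lparr>carrier := A\<rparr>)\<lparr>carrier := F A A\<rparr>"

text \<open>The automorphism \<open>\<phi> c\<^sub>g \<phi>\<inverse>\<close> of \<open>C\<close> that occurs in \<^const>\<open>extension_domain\<close>.\<close>

definition conj_transport :: "('a, 'b) monoid_scheme \<Rightarrow> 'a set \<Rightarrow> 'a set \<Rightarrow> ('a \<Rightarrow> 'a) \<Rightarrow> 'a \<Rightarrow> 'a \<Rightarrow> 'a" where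
  "conj_transport S A C \<phi> g = (\<lambda>x\<in>C. \<phi> (g \<otimes>\<^bsub>S\<^esub> inv_into A \<phi> x \<otimes>\<^bsub>S\<^esub> inv\<^bsub>S\<^esub> g))"

context fusion_system
begin

lemma
  assumes P: "subgroup P S" "subgroup Q S" "\<phi> \<in> F P Q"
  shows morphism_closed: "x \<in> P \<Longrightarrow> \<phi> x \<in> Q"
    and morphism_mult: "\<lbrakk>x \<in> P; y \<in> P\<rbrakk> \<Longrightarrow> \<phi> (x \<otimes> y) = \<phi> x \<otimes> \<phi> y"
    and morphism_inj: "inj_on \<phi> P"
  using morphism_mon[OF P] by (auto simp: mon_def hom_def)

lemma morphism_group_hom:
  assumes P: "subgroup P S" "subgroup Q S" "\<phi> \<in> F P Q"
  shows "group_hom (S\<lparr>carrier := P\<rparr>) S \<phi>"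
  using morphism_closed[OF P] morphism_mult[OF P] subgroup.mem_carrier[OF P(2)]
    subgroup.subgroup_is_group[OF P(1) is_group]
  by (intro group_hom.intro group_hom_axioms.intro homI) auto

lemma morphism_one:
  assumes P: "subgroup P S" "subgroup Q S" "\<phi> \<in> F P Q"
  shows "\<phi> \<one> = \<one>"
  using group_hom.hom_one[OF morphism_group_hom[OF P]] by simp

lemma morphism_inv:
  assumes P: "subgroup P S" "subgroup Q S" "\<phi> \<in> F P Q" and x: "x \<in> P"
  shows "\<phi> (inv x) = inv (\<phi> x)"
  using group_hom.hom_inv[OF morphism_group_hom[OF P], of x] x P(1) by simp

lemma morphism_nat_pow:
  assumes P: "subgroup P S" "subgroup Q S" "\<phi> \<in> F P Q" and x: "x \<in> P"
  shows "\<phi> (x [^] (n::nat)) = \<phi> x [^] n"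
  using group_hom.hom_nat_pow[OF morphism_group_hom[OF P], of x n] x
  by (simp flip: nat_pow_consistent)

lemma morphism_image_subgroup:
  assumes P: "subgroup P S" "subgroup Q S" "\<phi> \<in> F P Q"
  shows "subgroup (\<phi> ` P) S"
  using group_hom.img_is_subgroup[OF morphism_group_hom[OF P]] by simp

lemma inclusion_morphism:
  assumes "subgroup P S" "subgroup Q S" "P \<subseteq> Q"
  shows "(\<lambda>x\<in>P. x) \<in> F P Q"
proof -
  have "(\<lambda>x\<in>P. x) = (\<lambda>x\<in>P. \<one> \<otimes> x \<otimes> inv \<one>)"
    using subgroup.mem_carrier[OF assms(1)] by (intro restrict_ext) auto
  moreover have "\<forall>x\<in>P. \<one> \<otimes> x \<otimes> inv \<one> \<in> Q"
    using subgroup.mem_carrier[OF assms(1)] assms(3) by auto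
  ultimately have "(\<lambda>x\<in>P. x) \<in> conj_hom S P Q" unfolding conj_hom_def using one_closed by blast
  then show ?thesis using conj_morphism[OF assms(1,2)] by blast
qed

lemma restrict_morphism:
  assumes "subgroup P S" "subgroup Q S" "\<phi> \<in> F P Q" "subgroup R S" "R \<subseteq> P"
  shows "restrict \<phi> R \<in> F R Q"
proof -
  have "compose R \<phi> (\<lambda>x\<in>R. x) \<in> F R Q"
    using compose_morphism[OF assms(4,1,2) inclusion_morphism[OF assms(4,1,5)] assms(3)] .
  moreover have "compose R \<phi> (\<lambda>x\<in>R. x) = restrict \<phi> R" by (auto simp: compose_def)
  ultimately show ?thesis by simp
qed

lemma inverse_morphism:
  assumes "subgroup P S" "subgroup Q S" "\<phi> \<in> F P Q" "\<phi> ` P = Q"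
  shows "restrict (inv_into P \<phi>) Q \<in> F Q P"
  using iso_onto_image[OF assms(1-3)] assms(4) by simp

lemma conjugation_morphism:
  assumes "A \<lhd> S" "g \<in> carrier S"
  shows "(\<lambda>x\<in>A. g \<otimes> x \<otimes> inv g) \<in> F A A"
proof -
  interpret A: normal A S by fact
  have "(\<lambda>x\<in>A. g \<otimes> x \<otimes> inv g) \<in> conj_hom S A A"
    unfolding conj_hom_def using assms(2) A.inv_op_closed2 by blast
  then show ?thesis using conj_morphism[OF A.subgroup_axioms A.subgroup_axioms] by blast
qed

lemma endo_image:
  assumes "subgroup A S" "\<phi> \<in> F A A"
  shows "\<phi> ` A = A"
  using endo_inj_surj[OF finite_subgroup[OF assms(1)] _ morphism_inj[OF assms(1,1,2)]]
    morphism_closed[OF assms(1,1,2)] by blast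

lemma endo_Bij:
  assumes "subgroup A S" "\<phi> \<in> F A A"
  shows "\<phi> \<in> Bij A"
  using endo_image[OF assms] morphism_inj[OF assms(1,1,2)] morphism_extensional[OF assms(1,1,2)]
  by (simp add: Bij_def bij_betw_def)

lemma aut_group_mult:
  assumes "subgroup A S" "\<phi> \<in> F A A" "\<psi> \<in> F A A"
  shows "\<phi> \<otimes>\<^bsub>aut_group S F A\<^esub> \<psi> = compose A \<phi> \<psi>"
  using endo_Bij[OF assms(1,2)] endo_Bij[OF assms(1,3)] by (simp add: AutoGroup_def BijGroup_def)

lemma aut_group_one: "\<one>\<^bsub>aut_group S F A\<^esub> = (\<lambda>x\<in>A. x)"
  by (simp add: AutoGroup_def BijGroup_def)

lemma group_aut_group:
  assumes A: "subgroup A S"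
  shows "group (aut_group S F A)"
proof (rule groupI)
  fix \<phi> \<psi> assume "\<phi> \<in> carrier (aut_group S F A)" "\<psi> \<in> carrier (aut_group S F A)"
  then show "\<phi> \<otimes>\<^bsub>aut_group S F A\<^esub> \<psi> \<in> carrier (aut_group S F A)"
    using aut_group_mult[OF A] compose_morphism[OF A A A] by simp
next
  show "\<one>\<^bsub>aut_group S F A\<^esub> \<in> carrier (aut_group S F A)"
    using inclusion_morphism[OF A A subset_refl] by (simp add: aut_group_one)
next
  fix \<phi> \<psi> \<theta> assume c: "\<phi> \<in> carrier (aut_group S F A)" "\<psi> \<in> carrier (aut_group S F A)"
    "\<theta> \<in> carrier (aut_group S F A)"
  then have "compose A (compose A \<phi> \<psi>) \<theta> = compose A \<phi> (compose A \<psi> \<theta>)"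
    using morphism_closed[OF A A, of \<theta>] by (intro compose_assoc[symmetric]) auto
  moreover have m: "\<phi> \<in> F A A" "\<psi> \<in> F A A" "\<theta> \<in> F A A" using c by simp_all
  ultimately show "\<phi> \<otimes>\<^bsub>aut_group S F A\<^esub> \<psi> \<otimes>\<^bsub>aut_group S F A\<^esub> \<theta>
      = \<phi> \<otimes>\<^bsub>aut_group S F A\<^esub> (\<psi> \<otimes>\<^bsub>aut_group S F A\<^esub> \<theta>)"
    unfolding aut_group_mult[OF A m(1,2)] aut_group_mult[OF A m(2,3)]
    by (simp only: aut_group_mult[OF A compose_morphism[OF A A A m(2,1)] m(3)]
        aut_group_mult[OF A m(1) compose_morphism[OF A A A m(3,2)]])
next
  fix \<phi> assume "\<phi> \<in> carrier (aut_group S F A)"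
  then have \<phi>: "\<phi> \<in> F A A" by simp
  have i: "(\<lambda>x\<in>A. x) \<in> F A A" using inclusion_morphism[OF A A subset_refl] .
  have "compose A (\<lambda>x\<in>A. x) \<phi> = \<phi>"
    using morphism_closed[OF A A \<phi>] morphism_extensional[OF A A \<phi>]
    by (auto simp: compose_def extensional_def)
  then show "\<one>\<^bsub>aut_group S F A\<^esub> \<otimes>\<^bsub>aut_group S F A\<^esub> \<phi> = \<phi>"
    using aut_group_mult[OF A i \<phi>] by (simp add: aut_group_one)
  have r: "restrict (inv_into A \<phi>) A \<in> F A A"
    using inverse_morphism[OF A A \<phi> endo_image[OF A \<phi>]] .
  have "restrict (inv_into A \<phi>) A \<otimes>\<^bsub>aut_group S F A\<^esub> \<phi> = \<one>\<^bsub>aut_group S F A\<^esub>"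
    using aut_group_mult[OF A r \<phi>] Bij_compose_restrict_eq[OF endo_Bij[OF A \<phi>]]
    by (simp add: aut_group_one)
  then show "\<exists>\<psi>\<in>carrier (aut_group S F A). \<psi> \<otimes>\<^bsub>aut_group S F A\<^esub> \<phi> = \<one>\<^bsub>aut_group S F A\<^esub>"
    using r by auto
qed

lemma finite_aut_group:
  assumes A: "subgroup A S"
  shows "finite (carrier (aut_group S F A))"
proof (rule finite_subset)
  show "carrier (aut_group S F A) \<subseteq> A \<rightarrow>\<^sub>E A"
    using morphism_closed[OF A A] morphism_extensional[OF A A] by (auto simp: PiE_def)
  show "finite (A \<rightarrow>\<^sub>E A)" using finite_subgroup[OF A] by (intro finite_PiE) auto
qed

lemma endo_eqI:
  assumes A: "subgroup A S" "\<phi> \<in> F A A" "\<psi> \<in> F A A" and eq: "\<And>x. x \<in> A \<Longrightarrow> \<phi> x = \<psi> x"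
  shows "\<phi> = \<psi>"
  using morphism_extensional[OF A(1,1,2)] morphism_extensional[OF A(1,1,3)] eq by (rule extensionalityI)

lemma conj_transport_morphism:
  assumes A: "A \<lhd> S" and C: "subgroup C S" and \<phi>: "\<phi> \<in> F A C" "\<phi> ` A = C" and g: "g \<in> carrier S"
  shows "conj_transport S A C \<phi> g \<in> F C C"
proof -
  have sA: "subgroup A S" using A by (simp add: normal_def)
  let ?c = "\<lambda>x\<in>A. g \<otimes> x \<otimes> inv g" and ?i = "restrict (inv_into A \<phi>) C"
  have "compose C \<phi> (compose C ?c ?i) \<in> F C C"
    using compose_morphism[OF C sA C _ \<phi>(1)]
      compose_morphism[OF C sA sA inverse_morphism[OF sA C \<phi>] conjugation_morphism[OF A g]] .
  moreover have "compose C \<phi> (compose C ?c ?i) = conj_transport S A C \<phi> g"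
    using inv_into_into[of _ \<phi> A] \<phi>(2) by (auto simp: compose_def conj_transport_def intro!: restrict_ext)
  ultimately show ?thesis by simp
qed

lemma conj_transport_image:
  assumes A: "subgroup A S" and C: "subgroup C S" and \<phi>: "\<phi> \<in> F A C" and x: "x \<in> A" 
  shows "conj_transport S A C \<phi> g (\<phi> x) = \<phi> (g \<otimes> x \<otimes> inv g)"
  using morphism_closed[OF A C \<phi> x] inv_into_f_f[OF morphism_inj[OF A C \<phi>] x]
  by (simp add: conj_transport_def)

lemma conj_transport_mult:
  assumes A: "A \<lhd> S" and C: "subgroup C S" and \<phi>: "\<phi> \<in> F A C" "\<phi> ` A = C"
    and g: "g \<in> carrier S" and h: "h \<in> carrier S"
  shows "conj_transport S A C \<phi> (g \<otimes> h) = compose C (conj_transport S A C \<phi> g) (conj_transport S A C \<phi> h)"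
proof -
  interpret A: normal A S by fact
  note sA = A.subgroup_axioms
  have "conj_transport S A C \<phi> (g \<otimes> h) x = conj_transport S A C \<phi> g (conj_transport S A C \<phi> h x)"
    if "x \<in> C" for x
  proof -
    obtain y where y: "y \<in> A" "x = \<phi> y" using \<open>x \<in> C\<close> \<phi>(2) by auto
    have "h \<otimes> y \<otimes> inv h \<in> A" using A.inv_op_closed2[OF h y(1)] .
    then show ?thesis
      using y g h by (simp add: conj_transport_image[OF sA C \<phi>(1)] mult_conj)
  qed
  then show ?thesis
    by (intro extensionalityI[where A = C]) (auto simp: compose_def conj_transport_def)
qed

lemma conj_transport_central:
  assumes A: "subgroup A S" and C: "subgroup C S" and \<phi>: "\<phi> \<in> F A C" "\<phi> ` A = C"
    and g: "g \<in> center S"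
  shows "conj_transport S A C \<phi> g = (\<lambda>x\<in>C. x)"
proof -
  have "conj_transport S A C \<phi> g x = x" if "x \<in> C" for x
  proof -
    obtain y where y: "y \<in> A" "x = \<phi> y" using \<open>x \<in> C\<close> \<phi>(2) by auto
    have "y \<in> carrier S" using A y(1) by (rule subgroup.mem_carrier)
    then have "g \<otimes> y = y \<otimes> g" using center_commute[OF g] by simp
    then have "g \<otimes> y \<otimes> inv g = y" using g \<open>y \<in> carrier S\<close> conj_fixes_iff_commute[of g y] by simp
    then show ?thesis using y by (simp add: conj_transport_image[OF A C \<phi>(1)])
  qed
  then show ?thesis
    by (intro extensionalityI[where A = C]) (auto simp: conj_transport_def)
qed

lemma conj_transport_pow:
  assumes A: "A \<lhd> S" and C: "subgroup C S" and \<phi>: "\<phi> \<in> F A C" "\<phi> ` A = C" and g: "g \<in> carrier S"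
  shows "conj_transport S A C \<phi> g [^]\<^bsub>aut_group S F C\<^esub> (n::nat) = conj_transport S A C \<phi> (g [^] n)"
proof -
  interpret AG: group "aut_group S F C" using C by (rule group_aut_group)
  show ?thesis
  proof (induction n)
    case 0
    have "\<one> \<in> center S" using subgroup.one_closed[OF subgroup_center] .
    then have "conj_transport S A C \<phi> \<one> = (\<lambda>x\<in>C. x)"
      using conj_transport_central[OF _ C \<phi>] A by (simp add: normal_def)
    then show ?case by (simp only: AG.nat_pow_0 nat_pow_0 aut_group_one)
  next
    case (Suc n)
    have "conj_transport S A C \<phi> g [^]\<^bsub>aut_group S F C\<^esub> Suc n
      = conj_transport S A C \<phi> (g [^] n) \<otimes>\<^bsub>aut_group S F C\<^esub> conj_transport S A C \<phi> g"
      by (simp only: AG.nat_pow_Suc Suc)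
    also have "\<dots> = compose C (conj_transport S A C \<phi> (g [^] n)) (conj_transport S A C \<phi> g)"
      using aut_group_mult[OF C conj_transport_morphism[OF A C \<phi>] conj_transport_morphism[OF A C \<phi>]] g
      by simp
    also have "\<dots> = conj_transport S A C \<phi> (g [^] n \<otimes> g)"
      using conj_transport_mult[OF A C \<phi>] g by simp
    finally show ?case by simp
  qed
qed

lemma extension_domain_eq:
  "extension_domain S Q P \<phi> = {g \<in> normalizer S Q. conj_transport S Q P \<phi> g \<in> conj_hom S P P}"
  by (simp add: extension_domain_def conj_transport_def)

end

subsection \<open>Automorphisms of an abelian maximal subgroup\<close>

lemma (in group) commutator_pow_left:
  assumes "x \<in> carrier G" "y \<in> carrier G" "commutator G x y \<in> center G"
  shows "commutator G (x [^] (n::nat)) y = commutator G x y [^] n"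
proof -
  have c: "commutator G y x \<in> center G"
    using subgroup.m_inv_closed[OF subgroup_center assms(3)] assms by (simp add: inv_commutator)
  have "commutator G (x [^] n) y = inv (commutator G y (x [^] n))"
    using assms by (simp add: inv_commutator)
  also have "\<dots> = inv (commutator G y x [^] n)"
    using commutator_pow_right[OF assms(2,1) c] by simp
  also have "\<dots> = commutator G x y [^] n"
    using assms by (simp add: inv_commutator flip: nat_pow_inv)
  finally show ?thesis .
qed

text \<open>The exponent is reduced modulo p to a natural number because the power rules for
  commutators and for morphisms are stated for natural exponents.\<close>

lemma (in two_abelian_maximals) derived_generator_nat:
  assumes s: "s \<in> D" "s \<noteq> \<one>" and e: "e \<in> D"
  shows "\<exists>k::nat. e = s [^] k"
proof -
  obtain k where k: "e = s [^] (k::int)" using derived_generator[OF assms] by blast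
  have sS: "s \<in> carrier S" using s(1) derived_central by auto
  have pp: "p > 0" using prime prime_gt_0_nat by blast
  have "s [^] (int p * (k div int p)) = (s [^] p) [^] (k div int p)"
    using sS by (simp add: int_pow_pow flip: int_pow_int)
  then have "s [^] (int p * (k div int p)) = \<one>" using derived_pow_p[OF s(1)] by simp
  then have "e = s [^] (k mod int p)"
    using k sS int_pow_mult[OF sS, of "int p * (k div int p)" "k mod int p"] by simp
  also have "\<dots> = s [^] nat (k mod int p)"
    using int_pow_int[of S s "nat (k mod int p)"] pp by simp
  finally show ?thesis by blast
qed

locale semi_invariant_fusion_system =
  saturated_fusion_system p S F + two_abelian_maximals p S M N
  for p :: nat and S (structure) and F M N +
  assumes odd: "odd p"
    and semi_inv: "\<And>B. maximal_subgroup B S \<Longrightarrow> semi_invariant S F B"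
begin

lemma maximal_image:
  assumes "maximal_subgroup B S" "\<alpha> \<in> F (carrier S) (carrier S)"
  shows "\<alpha> ` B = B"
  using semi_inv[OF assms(1)] assms(2) subgroup_self subgroup.subset[OF maximal_imp_subgroup[OF assms(1)]]
  unfolding semi_invariant_def by blast

end

text \<open>\<open>C\<close> stands for the good representative that saturation chooses in the
  F-conjugacy class of an abelian maximal subgroup. In the end,
  \<open>abelian_maximal_receptive\<close> shows that every abelian maximal subgroup of a nonabelian
  \<open>S\<close> is such a \<open>C\<close>.\<close>

locale receptive_abelian_maximal = semi_invariant_fusion_system +
  fixes C
  assumes max_C: "maximal_subgroup C S" and comm_C: "comm_group (S\<lparr>carrier := C\<rparr>)"
    and nonabelian: "center S \<noteq> carrier S"
    and fa_C: "fully_automized p S F C" and rec_C: "receptive S F C"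
begin

lemma sub_C: "subgroup C S"
  using maximal_imp_subgroup[OF max_C] .

lemma normal_C: "C \<lhd> S"
  using maximal_subgroup_normal[OF max_C] .

lemma C_carrier [simp]: "x \<in> C \<Longrightarrow> x \<in> carrier S"
  using subgroup.mem_carrier[OF sub_C] .

lemma center_C: "center S \<subseteq> C"
  using center_le_abelian_maximal[OF max_C comm_C nonabelian] .

lemma derived_C: "D \<subseteq> C"
  using derived_central center_C by blast

lemma conj_C: "g \<in> carrier S \<Longrightarrow> x \<in> C \<Longrightarrow> g \<otimes> x \<otimes> inv g \<in> C"
  using normal.inv_op_closed2[OF normal_C] .

lemma commute_C: "x \<in> C \<Longrightarrow> y \<in> C \<Longrightarrow> x \<otimes> y = y \<otimes> x"
  using abelian_commute[OF comm_C] .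

interpretation AG: group "aut_group S F C"
  using group_aut_group[OF sub_C] .

lemma endo_ops:
  assumes "\<phi> \<in> F C C"
  shows "x \<in> C \<Longrightarrow> \<phi> x \<in> C" "x \<in> C \<Longrightarrow> y \<in> C \<Longrightarrow> \<phi> (x \<otimes> y) = \<phi> x \<otimes> \<phi> y"
    "x \<in> C \<Longrightarrow> \<phi> (inv x) = inv (\<phi> x)" "x \<in> C \<Longrightarrow> \<phi> (x [^] (n::nat)) = \<phi> x [^] n"
  using morphism_closed[OF sub_C sub_C assms] morphism_mult[OF sub_C sub_C assms]
    morphism_inv[OF sub_C sub_C assms] morphism_nat_pow[OF sub_C sub_C assms] by blast+

lemma mult_aut_apply:
  assumes "\<phi> \<in> F C C" "\<psi> \<in> F C C" "x \<in> C"
  shows "(\<phi> \<otimes>\<^bsub>aut_group S F C\<^esub> \<psi>) x = \<phi> (\<psi> x)"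
  using aut_group_mult[OF sub_C assms(1,2)] assms(3) by (simp only: compose_eq)

lemma conj_transport_endo:
  assumes "\<phi> \<in> F C C" "g \<in> carrier S"
  shows "conj_transport S C C \<phi> g \<in> F C C"
  using conj_transport_morphism[OF normal_C sub_C assms(1) endo_image[OF sub_C assms(1)] assms(2)] .

text \<open>Full automization makes Aut_S(C) a Sylow p-subgroup of Aut_F(C), so membership reduces
  to two checks: the p-th power is trivial, and Aut_S(C) is normalized.\<close>

lemma in_conj_hom:
  assumes u: "u \<in> F C C" "u [^]\<^bsub>aut_group S F C\<^esub> p = \<one>\<^bsub>aut_group S F C\<^esub>"
    and norm: "\<And>v. v \<in> conj_hom S C C \<Longrightarrow>
      u \<otimes>\<^bsub>aut_group S F C\<^esub> v \<otimes>\<^bsub>aut_group S F C\<^esub> inv\<^bsub>aut_group S F C\<^esub> u \<in> conj_hom S C C"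
  shows "u \<in> conj_hom S C C"
proof (rule AG.normalizing_p_element_in_sylow[OF finite_aut_group[OF sub_C] prime])
  show "sylow_subgroup p (conj_hom S C C) (aut_group S F C)"
    using fa_C unfolding fully_automized_def .
  show "u \<in> carrier (aut_group S F C)" using u(1) by simp
qed (fact u(2) norm)+

lemma conj_hom_iff: "v \<in> conj_hom S C C \<longleftrightarrow> (\<exists>g\<in>carrier S. v = (\<lambda>x\<in>C. g \<otimes> x \<otimes> inv g))"
  using conj_C unfolding conj_hom_def by blast

lemma conj_hom_F: "v \<in> conj_hom S C C \<Longrightarrow> v \<in> F C C"
  using conj_morphism[OF sub_C sub_C] by blast

lemma conj_hom_conjI:
  assumes \<phi>: "\<phi> \<in> F C C" and k: "k \<in> carrier S" and l: "l \<in> carrier S"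
    and eq: "\<And>x. x \<in> C \<Longrightarrow> \<phi> (k \<otimes> x \<otimes> inv k) = l \<otimes> \<phi> x \<otimes> inv l"
  shows "\<phi> \<otimes>\<^bsub>aut_group S F C\<^esub> (\<lambda>x\<in>C. k \<otimes> x \<otimes> inv k) \<otimes>\<^bsub>aut_group S F C\<^esub> inv\<^bsub>aut_group S F C\<^esub> \<phi>
    \<in> conj_hom S C C" (is "\<phi> \<otimes>\<^bsub>?A\<^esub> ?v \<otimes>\<^bsub>?A\<^esub> _ \<in> _")
proof -
  let ?w = "\<lambda>x\<in>C. l \<otimes> x \<otimes> inv l"
  have v: "?v \<in> F C C" and w: "?w \<in> F C C"
    using conjugation_morphism[OF normal_C] k l by blast+
  have "\<phi> \<otimes>\<^bsub>?A\<^esub> ?v = ?w \<otimes>\<^bsub>?A\<^esub> \<phi>"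
  proof (rule endo_eqI[OF sub_C])
    show "\<phi> \<otimes>\<^bsub>?A\<^esub> ?v \<in> F C C" "?w \<otimes>\<^bsub>?A\<^esub> \<phi> \<in> F C C"
      using AG.m_closed[of \<phi> ?v] AG.m_closed[of ?w \<phi>] \<phi> v w by simp_all
    fix x assume x: "x \<in> C"
    show "(\<phi> \<otimes>\<^bsub>?A\<^esub> ?v) x = (?w \<otimes>\<^bsub>?A\<^esub> \<phi>) x"
      unfolding mult_aut_apply[OF \<phi> v x] mult_aut_apply[OF w \<phi> x]
      using eq[OF x] x endo_ops(1)[OF \<phi> x] by simp
  qed
  then have "\<phi> \<otimes>\<^bsub>?A\<^esub> ?v \<otimes>\<^bsub>?A\<^esub> inv\<^bsub>?A\<^esub> \<phi> = ?w"
    using AG.inv_solve_right'[of ?w "\<phi> \<otimes>\<^bsub>?A\<^esub> ?v" \<phi>] AG.m_closed[of \<phi> ?v] \<phi> v w by simp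
  then show ?thesis using l conj_hom_iff by blast
qed

text \<open>The p-th power is the transport of conjugation by g^p, which is trivial because g^p is
  central.\<close>

lemma transport_pow_p:
  assumes "\<phi> \<in> F C C" "g \<in> carrier S"
  shows "conj_transport S C C \<phi> g [^]\<^bsub>aut_group S F C\<^esub> p = \<one>\<^bsub>aut_group S F C\<^esub>"
  using conj_transport_pow[OF normal_C sub_C assms(1) endo_image[OF sub_C assms(1)] assms(2)]
    conj_transport_central[OF sub_C sub_C assms(1) endo_image[OF sub_C assms(1)] pow_p_central[OF assms(2)]]
  by (simp only: aut_group_one)

lemma transport_apply:
  assumes \<phi>: "\<phi> \<in> F C C" and g: "g \<in> carrier S" and y: "y \<in> C"
  shows "conj_transport S C C \<phi> g (\<phi> y) = \<phi> (commutator S g y) \<otimes> \<phi> y"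
proof -
  have "commutator S g y \<in> C" using commutator_derived g y derived_C by auto
  then show ?thesis
    using conj_transport_image[OF sub_C sub_C \<phi> y, of g] conj_eq_commutator_mult[of g y] g y
      endo_ops(2)[OF \<phi>] by simp
qed

lemma transport_derived_central:
  assumes \<phi>: "\<phi> \<in> F C C" and D\<phi>: "\<And>e. e \<in> D \<Longrightarrow> \<phi> e \<in> center S"
    and g: "g \<in> carrier S" and z: "z \<in> D"
  shows "conj_transport S C C \<phi> g z \<in> center S"
proof -
  have "z \<in> \<phi> ` C" using z derived_C endo_image[OF sub_C \<phi>] by auto
  then obtain y where y: "y \<in> C" "z = \<phi> y" by auto
  have "\<phi> (commutator S g y) \<in> center S" using D\<phi> commutator_derived g y by simp
  moreover have "\<phi> y \<in> center S" using y z derived_central by blast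
  ultimately show ?thesis
    using transport_apply[OF \<phi> g y(1)] y subgroup.m_closed[OF subgroup_center] by simp
qed

lemma transport_inv_apply:
  assumes \<phi>: "\<phi> \<in> F C C" and g: "g \<in> carrier S" and x: "x \<in> C"
  shows "conj_transport S C C \<phi> g (conj_transport S C C \<phi> (inv g) x) = x"
proof -
  have im: "\<phi> ` C = C" using endo_image[OF sub_C \<phi>] .
  have "conj_transport S C C \<phi> \<one> x = x"
    using conj_transport_central[OF sub_C sub_C \<phi> im subgroup.one_closed[OF subgroup_center]] x by simp
  then show ?thesis
    using conj_transport_mult[OF normal_C sub_C \<phi> im g, of "inv g"] g x by (simp add: compose_def)
qed

text \<open>
  If \<open>\<phi>\<close> maps the derived subgroup into the center, then every conjugate of \<open>c\<^sub>k\<close> under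
  \<open>\<phi> c\<^sub>g \<phi>\<inverse>\<close> commutes with \<open>Aut\<^sub>S(C)\<close> and so lies in this Sylow subgroup; hence
  \<open>\<phi> c\<^sub>g \<phi>\<inverse>\<close> normalizes \<open>Aut\<^sub>S(C)\<close> and lies in it, too.
\<close>

lemma conj_hom_invariant_of_central:
  assumes \<phi>: "\<phi> \<in> F C C" and D\<phi>: "\<And>e. e \<in> D \<Longrightarrow> \<phi> e \<in> center S" and v: "v \<in> conj_hom S C C"
  shows "\<phi> \<otimes>\<^bsub>aut_group S F C\<^esub> v \<otimes>\<^bsub>aut_group S F C\<^esub> inv\<^bsub>aut_group S F C\<^esub> \<phi> \<in> conj_hom S C C"
proof -
  obtain g where g: "g \<in> carrier S" "v = (\<lambda>x\<in>C. g \<otimes> x \<otimes> inv g)" using v conj_hom_iff by blast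
  let ?t = "conj_transport S C C \<phi> g"
  have t: "?t \<in> F C C" using conj_transport_endo[OF \<phi> g(1)] .
  have tT: "conj_transport S C C ?t k \<in> conj_hom S C C" if k: "k \<in> carrier S" for k
  proof -
    let ?T = "conj_transport S C C ?t k"
    have T: "?T \<in> F C C" using conj_transport_endo[OF t k] .
    \<comment> \<open>The map \<open>?T\<close> is t c_k t^-1 with t = \<open>?t\<close>. The
      preimage t^-1 z is again central, so c_k fixes it and \<open>?T\<close> fixes z.\<close>
    have Tz: "?T z = z" if z: "z \<in> D" for z
    proof -
      let ?y = "conj_transport S C C \<phi> (inv g) z"
      have yZ: "?y \<in> center S" using transport_derived_central[OF \<phi> D\<phi> _ z] g by simp
      then have yC: "?y \<in> C" using center_C by blast
      have ty: "?t ?y = z" using transport_inv_apply[OF \<phi> g(1)] z derived_C by blast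
      have "commutator S k ?y = \<one>"
        using center_commute[OF yZ k] k yC by (simp add: commutator_eq_one_iff)
      then show ?thesis
        using transport_apply[OF t k yC] ty morphism_one[OF sub_C sub_C t] z derived_C by auto
    qed
    \<comment> \<open>\<open>?T\<close> also moves each element of \<open>C\<close> only by a
      central factor. Since it fixes every commutator [l, x], the two facts make \<open>?T\<close>
      commute with every c_l.\<close>
    have Tx: "\<exists>m. m \<in> center S \<and> ?T x = m \<otimes> x" if x: "x \<in> C" for x
    proof -
      have "x \<in> ?t ` C" using x endo_image[OF sub_C t] by simp
      then obtain y where y: "y \<in> C" "x = ?t y" by blast
      have "?t (commutator S k y) \<in> center S"
        using transport_derived_central[OF \<phi> D\<phi> g(1)] commutator_derived k y(1) by simp
      then show ?thesis using transport_apply[OF t k y(1)] y(2) by metis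
    qed
    have "?T (l \<otimes> x \<otimes> inv l) = l \<otimes> ?T x \<otimes> inv l" if l: "l \<in> carrier S" and x: "x \<in> C" for l x
    proof -
      obtain m where m: "m \<in> center S" "?T x = m \<otimes> x" using Tx[OF x] by blast
      have c: "commutator S l x \<in> D" using commutator_derived l x by simp
      have "?T (l \<otimes> x \<otimes> inv l) = ?T (commutator S l x \<otimes> x)"
        using conj_eq_commutator_mult l x by simp
      also have "\<dots> = commutator S l x \<otimes> (m \<otimes> x)"
        using endo_ops(2)[OF T _ x] c derived_C Tz[OF c] m(2) by auto
      also have "\<dots> = m \<otimes> (commutator S l x \<otimes> x)"
        using center_commute[OF m(1), of "commutator S l x"] m(1) l x by (simp flip: m_assoc)
      also have "\<dots> = m \<otimes> (l \<otimes> x \<otimes> inv l)" using conj_eq_commutator_mult l x by simp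
      also have "\<dots> = (l \<otimes> m \<otimes> inv l) \<otimes> (l \<otimes> x \<otimes> inv l)" using center_conj[OF m(1) l] by simp
      also have "\<dots> = l \<otimes> ?T x \<otimes> inv l" using conj_mult[of l m x] m l x by simp
      finally show ?thesis .
    qed
    then have "?T \<otimes>\<^bsub>aut_group S F C\<^esub> w \<otimes>\<^bsub>aut_group S F C\<^esub> inv\<^bsub>aut_group S F C\<^esub> ?T \<in> conj_hom S C C"
      if "w \<in> conj_hom S C C" for w
      using that conj_hom_conjI[OF T] conj_hom_iff by auto
    then show ?thesis by (rule in_conj_hom[OF T transport_pow_p[OF t k]])
  qed
  have "?t \<otimes>\<^bsub>aut_group S F C\<^esub> w \<otimes>\<^bsub>aut_group S F C\<^esub> inv\<^bsub>aut_group S F C\<^esub> ?t \<in> conj_hom S C C"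
    if w: "w \<in> conj_hom S C C" for w
  proof -
    obtain k where k: "k \<in> carrier S" "w = (\<lambda>x\<in>C. k \<otimes> x \<otimes> inv k)" using w conj_hom_iff by blast
    obtain l where l: "l \<in> carrier S" "conj_transport S C C ?t k = (\<lambda>x\<in>C. l \<otimes> x \<otimes> inv l)"
      using tT[OF k(1)] conj_hom_iff by blast
    have "?t (k \<otimes> x \<otimes> inv k) = l \<otimes> ?t x \<otimes> inv l" if x: "x \<in> C" for x
      using conj_transport_image[OF sub_C sub_C t x, of k] l(2) endo_ops(1)[OF t x] by simp
    then show ?thesis using conj_hom_conjI[OF t k(1) l(1)] k(2) by simp
  qed
  then have "?t \<in> conj_hom S C C" by (rule in_conj_hom[OF t transport_pow_p[OF \<phi> g(1)]])
  then obtain l where l: "l \<in> carrier S" "?t = (\<lambda>x\<in>C. l \<otimes> x \<otimes> inv l)" using conj_hom_iff by blast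
  have "\<phi> (g \<otimes> x \<otimes> inv g) = l \<otimes> \<phi> x \<otimes> inv l" if x: "x \<in> C" for x
    using conj_transport_image[OF sub_C sub_C \<phi> x, of g] l(2) endo_ops(1)[OF \<phi> x] by simp
  then show ?thesis using conj_hom_conjI[OF \<phi> g(1) l(1)] g(2) by simp
qed

text \<open>This is where p odd enters: 2 is prime to p, so \<open>x\<close> is a power of its
  square.\<close>

lemma square_central:
  assumes "x \<in> carrier S" "x \<otimes> x \<in> center S"
  shows "x \<in> center S"
proof -
  have "x [^] (2::int) \<in> center S"
    using assms int_pow_int[of S x 2] by (simp add: numeral_2_eq_2)
  moreover have "\<not> int p dvd 2"
  proof
    assume "int p dvd 2"
    then have "p dvd 2" by (metis int_dvd_int_iff of_nat_numeral)
    then have "p = 2" using prime by (simp add: primes_dvd_imp_eq two_is_prime_nat)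
    then show False using odd by simp
  qed
  ultimately show ?thesis using int_pow_coprime_mem[OF subgroup_center assms(1)] by blast
qed

text \<open>Here i c_g i^-1 = c_g already lies in Aut_S(C), and \<open>C\<close> is normal, so no
  element of \<open>S\<close> is excluded from N_i.\<close>

lemma extension_domain_endo:
  assumes i: "i \<in> F C C" and comm: "\<And>g x. g \<in> carrier S \<Longrightarrow> x \<in> C \<Longrightarrow> i (g \<otimes> x \<otimes> inv g) = g \<otimes> i x \<otimes> inv g"
  shows "extension_domain S C C i = carrier S"
proof -
  have "conj_transport S C C i g \<in> conj_hom S C C" if g: "g \<in> carrier S" for g
  proof -
    have "conj_transport S C C i g x = g \<otimes> x \<otimes> inv g" if x: "x \<in> C" for x
    proof -
      have "x \<in> i ` C" using x endo_image[OF sub_C i] by simp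
      then obtain y where y: "y \<in> C" "x = i y" by blast
      then show ?thesis using conj_transport_image[OF sub_C sub_C i y(1)] comm[OF g y(1)] by simp
    qed
    then have "conj_transport S C C i g = (\<lambda>x\<in>C. g \<otimes> x \<otimes> inv g)"
      by (intro extensionalityI[where A = C]) (auto simp: conj_transport_def)
    then show ?thesis using g conj_hom_iff by blast
  qed
  then show ?thesis using mem_normalizer_normal[OF normal_C] by (auto simp: extension_domain_eq)
qed

text \<open>
  The endomorphism \<open>i\<close> extends to \<open>\<alpha>\<close> on \<open>S\<close>.  Since \<open>\<alpha>\<close> preserves the maximal subgroups
  \<open>C\<^sub>S(h)\<close> and \<open>C\<^sub>S(hs)\<close>, where \<open>h \<notin> C\<close>, it fixes \<open>h\<close> modulo the center and cannot invert
  \<open>s\<close> unless \<open>s\<^sup>2\<close> is central.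
\<close>

lemma inverted_by_commuting_endo_central:
  assumes i: "i \<in> F C C" and comm: "\<And>g x. g \<in> carrier S \<Longrightarrow> x \<in> C \<Longrightarrow> i (g \<otimes> x \<otimes> inv g) = g \<otimes> i x \<otimes> inv g"
    and s: "s \<in> C" "i s = inv s"
  shows "s \<in> center S"
proof -
  note sS = subgroup_self
  have "\<exists>\<psi>\<in>F (extension_domain S C C i) (carrier S). \<forall>x\<in>C. \<psi> x = i x"
    using rec_C sub_C i endo_image[OF sub_C i] unfolding receptive_def by blast
  then have "\<exists>\<psi>\<in>F (carrier S) (carrier S). \<forall>x\<in>C. \<psi> x = i x"
    using extension_domain_endo[OF i comm] by simp
  then obtain \<alpha> where \<alpha>: "\<alpha> \<in> F (carrier S) (carrier S)" "\<And>x. x \<in> C \<Longrightarrow> \<alpha> x = i x" by blast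
  obtain h where h: "h \<in> carrier S" "h \<notin> C"
    using max_C subgroup.subset[OF sub_C] unfolding maximal_subgroup_def by blast
  have noncentral: "x \<notin> center S" if "x \<notin> C" for x using that center_C by blast
  have ah: "\<alpha> h \<in> carrier S" using morphism_closed[OF sS sS \<alpha>(1) h(1)] .
  define v where "v = inv h \<otimes> \<alpha> h"
  have vS: "v \<in> carrier S" using h ah by (simp add: v_def)
  have hv: "\<alpha> h = h \<otimes> v" using h ah by (simp add: v_def cancel_left_mult)
  \<comment> \<open>Conjugation by h and by \<alpha> h = h v have the same effect on i(C) = C: one
    because i commutes with c_h, the other because \<alpha> is a homomorphism extending i.
    Cancelling h leaves conjugation by v trivial on \<open>C\<close>.\<close>
  have vcomm: "v \<otimes> x = x \<otimes> v" if x: "x \<in> C" for x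
  proof -
    have "x \<in> i ` C" using x endo_image[OF sub_C i] by simp
    then obtain y where y: "y \<in> C" "x = i y" by blast
    have "i (h \<otimes> y \<otimes> inv h) = \<alpha> (h \<otimes> y \<otimes> inv h)" using \<alpha>(2) conj_C[OF h(1) y(1)] by simp
    also have "\<dots> = \<alpha> h \<otimes> x \<otimes> inv (\<alpha> h)"
      using h y \<alpha>(2)[OF y(1)] by (simp add: morphism_mult[OF sS sS \<alpha>(1)] morphism_inv[OF sS sS \<alpha>(1)])
    also have "\<dots> = h \<otimes> (v \<otimes> x \<otimes> inv v) \<otimes> inv h" using mult_conj[OF h(1) vS, of x] hv x by simp
    finally have "h \<otimes> (v \<otimes> x \<otimes> inv v) \<otimes> inv h = h \<otimes> x \<otimes> inv h" using comm[OF h(1) y(1)] y(2) by simp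
    then have "v \<otimes> x \<otimes> inv v = x" using h vS x by simp
    then show ?thesis using conj_fixes_iff_commute[OF vS] x by simp
  qed
  have vC: "v \<in> C"
  proof (rule ccontr)
    assume "v \<notin> C"
    then have CZ: "C \<subseteq> center S" using abelian_maximal_central[OF max_C comm_C _ vS] vcomm by blast
    have "h \<in> centralizer S h" "C \<subseteq> centralizer S h"
      using h CZ center_commute by (auto simp: centralizer_def)
    then have "centralizer S h = carrier S"
      by (intro maximal_subgroup_eq_carrier[OF max_C subgroup_centralizer[OF h(1)] _ _ h(2)])
    then show False using centralizer_eq_carrier_imp_center[OF _ h(1)] noncentral[OF h(2)] by blast
  qed
  have maxB: "\<alpha> x \<in> centralizer S x" if x: "x \<in> carrier S" "x \<notin> C" for x
    using maximal_image[OF centralizer_maximal(1)[OF x(1) noncentral[OF x(2)]] \<alpha>(1)] x(1)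
    by (auto simp: centralizer_def)
  \<comment> \<open>Invariance of the centralizer of h makes v commute with h; as v lies in the
    abelian \<open>C\<close> and h lies outside, v is central.\<close>
  have "h \<otimes> v \<in> centralizer S h" using maxB[OF h] hv by simp
  moreover have "h \<in> centralizer S h" using h(1) by (simp add: centralizer_def)
  ultimately have "inv h \<otimes> (h \<otimes> v) \<in> centralizer S h"
    using subgroup.m_closed[OF subgroup_centralizer[OF h(1)]]
      subgroup.m_inv_closed[OF subgroup_centralizer[OF h(1)]] by blast
  then have "v \<otimes> h = h \<otimes> v" using h vS by (simp add: cancel_left_mult centralizer_def)
  then have vZ: "v \<in> center S" using abelian_maximal_central[OF max_C comm_C vC h] by simp
  have hs: "h \<otimes> s \<in> carrier S" "h \<otimes> s \<notin> C"
    using h s subgroup.m_closed[OF sub_C _ subgroup.m_inv_closed[OF sub_C s(1)], of "h \<otimes> s"] by (auto simp: m_assoc)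
  let ?B = "centralizer S (h \<otimes> s)"
  note B = subgroup_centralizer[OF hs(1)]
  have vB: "inv v \<in> ?B"
    using subgroup.m_inv_closed[OF subgroup_center vZ] center_commute hs(1) by (auto simp: centralizer_def)
  have hsB: "h \<otimes> s \<in> ?B" using hs(1) by (simp add: centralizer_def)
  have "\<alpha> (h \<otimes> s) = h \<otimes> v \<otimes> inv s"
    using morphism_mult[OF sS sS \<alpha>(1)] \<alpha>(2)[OF s(1)] s h hv by simp
  also have "\<dots> = v \<otimes> (h \<otimes> inv s)" using center_commute[OF vZ h(1)] h s vS by (simp flip: m_assoc)
  finally have "v \<otimes> (h \<otimes> inv s) \<in> ?B" using maxB[OF hs] by simp
  then have "inv v \<otimes> (v \<otimes> (h \<otimes> inv s)) \<in> ?B" using subgroup.m_closed[OF B vB] by blast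
  then have "h \<otimes> inv s \<in> ?B" using vS h s by (simp add: cancel_left_mult)
  \<comment> \<open>Up to the central factor v, \<alpha> turns h s into h s^-1, so \<open>?B\<close>
    contains both. Their quotient s^2 therefore commutes with h s, which is outside
    \<open>C\<close>.\<close>
  then have "inv (h \<otimes> inv s) \<otimes> (h \<otimes> s) \<in> ?B"
    using subgroup.m_closed[OF B subgroup.m_inv_closed[OF B] hsB] by blast
  moreover have "inv (h \<otimes> inv s) \<otimes> (h \<otimes> s) = s \<otimes> s"
    using h s by (simp add: inv_mult_group m_assoc cancel_left_mult)
  ultimately have "(h \<otimes> s) \<otimes> (s \<otimes> s) = (s \<otimes> s) \<otimes> (h \<otimes> s)" by (simp add: centralizer_def)
  then have "s \<otimes> s \<in> center S"
    using abelian_maximal_central[OF max_C comm_C _ hs] subgroup.m_closed[OF sub_C s(1) s(1)] by simp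
  then show ?thesis using square_central[OF C_carrier[OF s(1)]] by blast
qed

end

section \<open>Normality of Aut_S(C) in Aut_F(C)\<close>

context receptive_abelian_maximal
begin

interpretation AG: group "aut_group S F C"
  using group_aut_group[OF sub_C] .

text \<open>The g for which c_g commutes with \<open>i\<close> form a subgroup. It contains
  \<open>C\<close>, which acts trivially on itself, and h outside \<open>C\<close>, so it is
  \<open>S\<close>.\<close>

lemma commuting_with_outer_generator:
  assumes i: "i \<in> F C C" and h: "h \<in> carrier S" "h \<notin> C"
    and comm: "\<And>x. x \<in> C \<Longrightarrow> i (h \<otimes> x \<otimes> inv h) = h \<otimes> i x \<otimes> inv h"
    and g: "g \<in> carrier S" and x: "x \<in> C"
  shows "i (g \<otimes> x \<otimes> inv g) = g \<otimes> i x \<otimes> inv g"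
proof -
  let ?L = "{g \<in> carrier S. \<forall>x\<in>C. i (g \<otimes> x \<otimes> inv g) = g \<otimes> i x \<otimes> inv g}"
  have CL: "C \<subseteq> ?L"
  proof
    fix c assume c: "c \<in> C"
    have "c \<otimes> x \<otimes> inv c = x" if "x \<in> C" for x
      using conj_fixes_iff_commute[of c x] commute_C[OF c that] c that by simp
    then show "c \<in> ?L" using c endo_ops(1)[OF i] by simp
  qed
  have "subgroup ?L S"
  proof (rule finite_subgroupI[OF finite_carrier])
    show "?L \<noteq> {}" using h(1) comm by blast
    fix a b assume ab: "a \<in> ?L" "b \<in> ?L"
    have "i (a \<otimes> b \<otimes> x \<otimes> inv (a \<otimes> b)) = a \<otimes> b \<otimes> i x \<otimes> inv (a \<otimes> b)" if x: "x \<in> C" for x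
      using ab conj_C[of b x] x endo_ops(1)[OF i x] by (simp add: mult_conj)
    then show "a \<otimes> b \<in> ?L" using ab by simp
  qed auto
  moreover have "h \<in> ?L" using h(1) comm by simp
  ultimately have "?L = carrier S" by (intro maximal_subgroup_eq_carrier[OF max_C _ CL _ h(2)])
  then have "g \<in> ?L" using g by simp
  then show ?thesis using x by simp
qed

text \<open>
  Here \<open>t = c\<^sub>h\<close> and the conjugate \<open>u\<close> act on \<open>\<langle>s, s1\<rangle>\<close> as the two standard generators of
  \<open>SL\<^sub>2(p)\<close>, so that \<open>(tut)\<^sup>2\<close> acts as \<open>-1\<close> on \<open>\<langle>s, s1\<rangle>\<close> and trivially on the complement
  \<open>C\<^bsub>C\<^esub>(t) \<inter> C\<^bsub>C\<^esub>(u)\<close>.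
\<close>

lemma opposed_conjugates_False:
  assumes \<phi>: "\<phi> \<in> F C C" and \<psi>: "\<psi> \<in> F C C"
    and inv: "\<And>x. x \<in> C \<Longrightarrow> \<phi> (\<psi> x) = x"
    and e1: "e1 \<in> D" "\<phi> e1 \<notin> center S" and e: "e \<in> D" "\<psi> e \<notin> center S"
  shows False
proof -
  obtain h where h: "h \<in> carrier S" "h \<notin> C"
    using max_C subgroup.subset[OF sub_C] unfolding maximal_subgroup_def by blast
  have DC: "z \<in> C" "z \<in> center S" if "z \<in> D" for z using that derived_C derived_central by blast+
  have nontriv: "commutator S h y \<noteq> \<one>" if "y \<in> C" "y \<notin> center S" for y
    using abelian_maximal_central[OF max_C comm_C that(1) h] that commutator_eq_one_iff[OF h(1), of y] by auto
  define s1 where "s1 = \<phi> e1"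
  have s1: "s1 \<in> C" "s1 \<notin> center S" using endo_ops(1)[OF \<phi> DC(1)[OF e1(1)]] e1(2) by (simp_all add: s1_def)
  define s where "s = commutator S h s1"
  have sD: "s \<in> D" using commutator_derived h s1 by (simp add: s_def)
  have s: "s \<in> C" "s \<in> center S" using DC[OF sD] by auto
  have "s \<noteq> \<one>" using nontriv[OF s1] by (simp add: s_def)
  then obtain k0 where k0: "e = s [^] (k0::nat)" using derived_generator_nat[OF sD _ e(1)] by blast
  \<comment> \<open>The element e is a power of s because s generates \<open>D\<close>. Since \<psi>
    e is noncentral, \<psi> s is noncentral too, and [h, y] is another generator of
    \<open>D\<close>.\<close>
  define y where "y = \<psi> s"
  have yC: "y \<in> C" using endo_ops(1)[OF \<psi> s(1)] by (simp add: y_def)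
  have "y \<notin> center S"
  proof
    assume "y \<in> center S"
    then have "y [^] int k0 \<in> center S" by (rule subgroup_int_pow_closed[OF subgroup_center])
    then show False using e(2) k0 endo_ops(4)[OF \<psi> s(1)] by (simp add: y_def int_pow_int)
  qed
  \<comment> \<open>The power of h is adjusted so that [h', y] = e1^-1. This normalizes u to u s =
    s1^-1 s, with entry -1 opposite to the entry 1 in t s1 = s s1.\<close>
  then obtain k where "inv e1 = commutator S h y [^] (k::nat)"
    using derived_generator_nat[OF commutator_derived[OF h(1)] nontriv[OF yC]
        subgroup.m_inv_closed[OF subgroup_derived e1(1)]] yC by auto
  moreover define h' where "h' = h [^] k"
  ultimately have h'y: "commutator S h' y = inv e1"
    using commutator_pow_left[OF h(1) _ commutator_central[OF h(1)], of y] yC by simp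
  have h': "h' \<in> carrier S" using h by (simp add: h'_def)
  define t where "t = (\<lambda>x\<in>C. h \<otimes> x \<otimes> inv h)"
  define u where "u = conj_transport S C C \<phi> h'"
  have t: "t \<in> F C C" using conjugation_morphism[OF normal_C h(1)] by (simp add: t_def)
  have u: "u \<in> F C C" using conj_transport_endo[OF \<phi> h'] by (simp add: u_def)
  have t_apply: "t x = commutator S h x \<otimes> x" if "x \<in> C" for x
    using that h conj_eq_commutator_mult[of h x] by (simp add: t_def)
  have u_apply: "u x = \<phi> (commutator S h' (\<psi> x)) \<otimes> x" if x: "x \<in> C" for x
    using transport_apply[OF \<phi> h' endo_ops(1)[OF \<psi> x]] inv[OF x] by (simp add: u_def)
  have ts: "t s = s"
    using t_apply[OF s(1)] commutator_eq_one_iff[OF h(1), of s] center_commute[OF s(2) h(1)] s by simp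
  have ts1: "t s1 = s \<otimes> s1" using t_apply[OF s1(1)] by (simp add: s_def)
  have us: "u s = inv s1 \<otimes> s"
    using u_apply[OF s(1)] h'y endo_ops(3)[OF \<phi> DC(1)[OF e1(1)]] by (simp add: y_def s1_def)
  have us1: "u s1 = s1"
  proof -
    have e1C: "e1 \<in> C" using DC e1 by blast
    have "commutator S h' e1 = \<one>"
      using commutator_eq_one_iff[OF h', of e1] center_commute[OF DC(2)[OF e1(1)] h'] e1C by simp
    then show ?thesis
      using transport_apply[OF \<phi> h' e1C] morphism_one[OF sub_C sub_C \<phi>] s1(1) by (simp add: u_def s1_def)
  qed
  have tpow: "\<exists>k::nat. t x = s [^] k \<otimes> x" if x: "x \<in> C" for x
    using derived_generator_nat[OF sD \<open>s \<noteq> \<one>\<close> commutator_derived[OF h(1)], of x] t_apply[OF x] x by auto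
  have upow: "\<exists>k::nat. u x = s1 [^] k \<otimes> x" if x: "x \<in> C" for x
  proof -
    have "e1 \<noteq> \<one>" using e1(2) morphism_one[OF sub_C sub_C \<phi>] subgroup.one_closed[OF subgroup_center] by auto
    moreover have "commutator S h' (\<psi> x) \<in> D"
      using commutator_derived[OF h'] endo_ops(1)[OF \<psi> x] by simp
    ultimately obtain k where "commutator S h' (\<psi> x) = e1 [^] (k::nat)"
      using derived_generator_nat[OF e1(1)] by blast
    then have "u x = s1 [^] k \<otimes> x"
      using u_apply[OF x] endo_ops(4)[OF \<phi> DC(1)[OF e1(1)]] by (simp add: s1_def)
    then show ?thesis by blast
  qed
  note tm = endo_ops[OF t] and um = endo_ops[OF u]
  have isC: "inv s1 \<in> C" "inv s \<in> C" using s s1 subgroup.m_inv_closed[OF sub_C] by blast+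
  \<comment> \<open>With entries 1 and -1, tut is the Weyl element s -> s1^-1, s1 -> s; its square
    inverts both.\<close>
  define w where "w = compose C t (compose C u t)"
  have w: "w \<in> F C C"
    unfolding w_def using compose_morphism[OF sub_C sub_C sub_C] t u by blast
  have w_apply: "w x = t (u (t x))" if "x \<in> C" for x using that by (simp add: w_def compose_eq)
  have ws: "w s = inv s1"
  proof -
    have "w s = t (inv s1 \<otimes> s)" using w_apply[OF s(1)] ts us by simp
    also have "\<dots> = inv (s \<otimes> s1) \<otimes> s" using tm(2)[OF isC(1) s(1)] tm(3)[OF s1(1)] ts ts1 by simp
    also have "\<dots> = inv s1" using s s1 by (simp add: inv_mult_group m_assoc)
    finally show ?thesis .
  qed
  have ws1: "w s1 = s"
  proof -
    have "w s1 = t (u (s \<otimes> s1))" using w_apply[OF s1(1)] ts1 by simp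
    also have "u (s \<otimes> s1) = inv s1 \<otimes> s \<otimes> s1" using um(2)[OF s(1) s1(1)] us us1 by simp
    also have "inv s1 \<otimes> s \<otimes> s1 = s"
      using commute_C[OF s(1) s1(1)] s s1 by (simp add: m_assoc cancel_left_mult)
    finally show ?thesis using ts by simp
  qed
  define i where "i = compose C w w"
  have i: "i \<in> F C C" unfolding i_def using compose_morphism[OF sub_C sub_C sub_C w w] .
  note im = endo_ops[OF i]
  have i_apply: "i x = w (w x)" if "x \<in> C" for x using that by (simp add: i_def compose_eq)
  have is0: "i s = inv s" using i_apply[OF s(1)] ws endo_ops(3)[OF w s1(1)] ws1 by simp
  have is1: "i s1 = inv s1" using i_apply[OF s1(1)] ws1 ws by simp
  \<comment> \<open>It suffices that i commutes with t = c_h. The subgroup where they commute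
    contains s and s1; the rest is to write every x in \<open>C\<close> as a product of powers of
    these and an element fixed by both t and u, on which i is trivial.\<close>
  let ?K = "{x \<in> C. t (i x) = i (t x)}"
  have K: "subgroup ?K S"
  proof (rule finite_subgroupI[OF finite_carrier])
    show "?K \<noteq> {}"
      using subgroup.one_closed[OF sub_C] morphism_one[OF sub_C sub_C t] morphism_one[OF sub_C sub_C i] by force
    fix a b assume "a \<in> ?K" "b \<in> ?K"
    then show "a \<otimes> b \<in> ?K" using tm(1,2) im(1,2) subgroup.m_closed[OF sub_C] by simp
  qed auto
  have sK: "s \<in> ?K" using s is0 ts tm(3)[OF s(1)] by simp
  have s1K: "s1 \<in> ?K"
    using s s1 is1 ts1 tm(3)[OF s1(1)] im(2)[OF s(1) s1(1)] is0 commute_C[OF isC]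
    by (simp add: inv_mult_group)
  have CK: "x \<in> ?K" if x: "x \<in> C" for x
  proof -
    obtain k where k: "t x = s [^] (k::nat) \<otimes> x" using tpow[OF x] by blast
    let ?a = "s1 [^] k" and ?P = "s [^] k"
    have aC: "?a \<in> C" and PC: "?P \<in> C"
      using subgroup_int_pow_closed[OF sub_C, of _ "int k"] s s1 by (simp_all add: int_pow_int)
    have PZ: "?P \<in> center S"
      using subgroup_int_pow_closed[OF subgroup_center s(2), of "int k"] by (simp add: int_pow_int)
    have iaC: "inv ?a \<in> C" using subgroup.m_inv_closed[OF sub_C aC] .
    \<comment> \<open>t multiplies both x and s1^k by s^k, so their quotient is fixed by t.\<close>
    define y1 where "y1 = x \<otimes> inv ?a"
    have y1: "y1 \<in> C" using subgroup.m_closed[OF sub_C x iaC] by (simp add: y1_def)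
    have ta: "t ?a = ?P \<otimes> ?a"
      using tm(4)[OF s1(1)] ts1 pow_mult_distrib[OF commute_C[OF s(1) s1(1)]] s s1 by simp
    have "t y1 = ?P \<otimes> x \<otimes> inv (?P \<otimes> ?a)"
      using tm(2)[OF x iaC] tm(3)[OF aC] k ta by (simp add: y1_def)
    also have "\<dots> = ?P \<otimes> y1 \<otimes> inv ?P"
      using x aC PC unfolding y1_def by (simp add: inv_mult_group m_assoc)
    also have "\<dots> = y1"
      using conj_fixes_iff_commute[of ?P y1] center_commute[OF PZ, of y1] y1 PC by simp
    finally have ty1: "t y1 = y1" .
    obtain m where m: "u y1 = s1 [^] (m::nat) \<otimes> y1" using upow[OF y1] by blast
    let ?Q = "s1 [^] m" and ?b = "s [^] m"
    have QC: "?Q \<in> C" and bC: "?b \<in> C"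
      using subgroup_int_pow_closed[OF sub_C, of _ "int m"] s s1 by (simp_all add: int_pow_int)
    \<comment> \<open>u multiplies y1 by s1^m and s^m by s1^-m, so the product is fixed by u; it
      stays fixed by t because t s = s.\<close>
    define y2 where "y2 = y1 \<otimes> ?b"
    have y2: "y2 \<in> C" using subgroup.m_closed[OF sub_C y1 bC] by (simp add: y2_def)
    have ty2: "t y2 = y2" using tm(2)[OF y1 bC] tm(4)[OF s(1)] ts ty1 by (simp add: y2_def)
    have "u ?b = inv ?Q \<otimes> ?b"
      using um(4)[OF s(1)] us pow_mult_distrib[OF commute_C[OF isC(1) s(1)]] s s1 by (simp add: nat_pow_inv)
    then have "u y2 = (y1 \<otimes> ?Q) \<otimes> (inv ?Q \<otimes> ?b)"
      using um(2)[OF y1 bC] m commute_C[OF QC y1] by (simp add: y2_def)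
    also have "\<dots> = y2" using y1 QC bC by (simp add: y2_def m_assoc cancel_left_mult)
    finally have uy2: "u y2 = y2" .
    have wy2: "w y2 = y2" using w_apply[OF y2] ty2 uy2 by simp
    have "i y2 = y2" using i_apply[OF y2] wy2 by simp
    then have y2K: "y2 \<in> ?K" using y2 ty2 by simp
    have "?a \<in> ?K" "inv ?b \<in> ?K"
      using subgroup_int_pow_closed[OF K s1K, of "int k"]
        subgroup.m_inv_closed[OF K subgroup_int_pow_closed[OF K sK, of "int m"]]
      by (simp_all only: int_pow_int)
    then have "y2 \<otimes> inv ?b \<otimes> ?a \<in> ?K" using subgroup.m_closed[OF K] y2K by blast
    moreover have "y2 \<otimes> inv ?b \<otimes> ?a = x"
      using x aC bC by (simp add: y2_def y1_def m_assoc)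
    ultimately show ?thesis by simp
  qed
  have comm: "i (h \<otimes> x \<otimes> inv h) = h \<otimes> i x \<otimes> inv h" if x: "x \<in> C" for x
    using CK[OF x] x im(1)[OF x] by (simp add: t_def)
  have "s1 \<in> center S"
    by (rule inverted_by_commuting_endo_central[OF i commuting_with_outer_generator[OF i h comm] s1(1) is1])
  then show False using s1 by simp
qed

text \<open>By \<open>opposed_conjugates_False\<close>, at least one of \<phi> and its inverse sends
  \<open>D\<close> into the center, and that one normalizes Aut_S(C). If it is the inverse,
  conjugation by it is an injection of the finite set Aut_S(C) into itself, hence onto, and \<phi>
  normalizes Aut_S(C) as well.\<close>

lemma conj_hom_normal:
  assumes \<phi>: "\<phi> \<in> F C C" and v: "v \<in> conj_hom S C C"
  shows "\<phi> \<otimes>\<^bsub>aut_group S F C\<^esub> v \<otimes>\<^bsub>aut_group S F C\<^esub> inv\<^bsub>aut_group S F C\<^esub> \<phi> \<in> conj_hom S C C"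
    (is "\<phi> \<otimes>\<^bsub>?A\<^esub> v \<otimes>\<^bsub>?A\<^esub> _ \<in> ?P")
proof (cases "\<forall>e\<in>D. \<phi> e \<in> center S")
  case True
  then show ?thesis using conj_hom_invariant_of_central[OF \<phi> _ v] by blast
next
  case False
  then obtain e1 where e1: "e1 \<in> D" "\<phi> e1 \<notin> center S" by blast
  let ?\<psi> = "inv\<^bsub>?A\<^esub> \<phi>"
  have \<phi>A: "\<phi> \<in> carrier ?A" using \<phi> by simp
  have \<psi>A: "?\<psi> \<in> carrier ?A" using AG.inv_closed[OF \<phi>A] .
  then have \<psi>: "?\<psi> \<in> F C C" by simp
  have "\<phi> (?\<psi> x) = x" if x: "x \<in> C" for x
    using mult_aut_apply[OF \<phi> \<psi> x] AG.r_inv[OF \<phi>A] x by (simp only: aut_group_one) simp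
  then have cent: "?\<psi> e \<in> center S" if "e \<in> D" for e
    using opposed_conjugates_False[OF \<phi> \<psi> _ e1 that] by blast
  let ?f = "\<lambda>v. ?\<psi> \<otimes>\<^bsub>?A\<^esub> v \<otimes>\<^bsub>?A\<^esub> \<phi>"
  have PA: "w \<in> carrier ?A" if "w \<in> ?P" for w using conj_hom_F[OF that] by simp
  have "?f ` ?P \<subseteq> ?P"
    using conj_hom_invariant_of_central[OF \<psi> cent] AG.inv_inv[OF \<phi>A] by auto
  moreover have "inj_on ?f ?P"
  proof (rule inj_onI)
    fix v w assume vw: "v \<in> ?P" "w \<in> ?P" and eq: "?f v = ?f w"
    then have "?\<psi> \<otimes>\<^bsub>?A\<^esub> v = ?\<psi> \<otimes>\<^bsub>?A\<^esub> w"
      using AG.r_cancel[of "?\<psi> \<otimes>\<^bsub>?A\<^esub> v" \<phi> "?\<psi> \<otimes>\<^bsub>?A\<^esub> w"] AG.m_closed[OF \<psi>A] PA \<phi>A by blast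
    then show "v = w" using AG.l_cancel[of ?\<psi> v w] \<psi>A PA vw by blast
  qed
  moreover have "finite ?P"
    using finite_subset[OF _ finite_aut_group[OF sub_C]] PA by blast
  ultimately have "?f ` ?P = ?P" by (intro endo_inj_surj)
  then obtain v' where v': "v' \<in> ?P" "v = ?f v'" using v by blast
  have "\<phi> \<otimes>\<^bsub>?A\<^esub> v \<otimes>\<^bsub>?A\<^esub> ?\<psi> = v'"
  proof -
    have "\<phi> \<otimes>\<^bsub>?A\<^esub> v \<otimes>\<^bsub>?A\<^esub> ?\<psi> = \<phi> \<otimes>\<^bsub>?A\<^esub> (?\<psi> \<otimes>\<^bsub>?A\<^esub> v' \<otimes>\<^bsub>?A\<^esub> inv\<^bsub>?A\<^esub> ?\<psi>) \<otimes>\<^bsub>?A\<^esub> inv\<^bsub>?A\<^esub> \<phi>"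
      using v'(2) AG.inv_inv[OF \<phi>A] by (simp only:)
    then show ?thesis
      using AG.cancel_conj(2)[OF \<phi>A PA[OF v'(1)]] AG.inv_inv[OF \<phi>A] by (simp only:)
  qed
  then show ?thesis using v'(1) by simp
qed

text \<open>Each \<phi> c_g \<phi>^-1 has trivial p-th power and normalizes the normal Sylow
  subgroup Aut_S(C), so it lies there. Thus N_\<phi> is \<open>S\<close>, and receptivity of
  \<open>C\<close> gives the extension.\<close>

lemma iso_extends:
  assumes A: "maximal_subgroup A S" and \<phi>: "\<phi> \<in> F A C" "\<phi> ` A = C"
  shows "\<exists>\<alpha>\<in>F (carrier S) (carrier S). \<forall>x\<in>A. \<alpha> x = \<phi> x"
proof -
  have nA: "A \<lhd> S" using maximal_subgroup_normal[OF A] .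
  have sA: "subgroup A S" using maximal_imp_subgroup[OF A] .
  have "conj_transport S A C \<phi> g \<in> conj_hom S C C" if g: "g \<in> carrier S" for g
  proof (rule in_conj_hom)
    show T: "conj_transport S A C \<phi> g \<in> F C C" using conj_transport_morphism[OF nA sub_C \<phi> g] .
    show "conj_transport S A C \<phi> g [^]\<^bsub>aut_group S F C\<^esub> p = \<one>\<^bsub>aut_group S F C\<^esub>"
      using conj_transport_pow[OF nA sub_C \<phi> g]
        conj_transport_central[OF sA sub_C \<phi> pow_p_central[OF g]]
      by (simp only: aut_group_one)
  qed (rule conj_hom_normal[OF conj_transport_morphism[OF nA sub_C \<phi> g]])
  then have "extension_domain S A C \<phi> = carrier S"
    using mem_normalizer_normal[OF nA] by (auto simp: extension_domain_eq)
  moreover have "\<exists>\<psi>\<in>F (extension_domain S A C \<phi>) (carrier S). \<forall>x\<in>A. \<psi> x = \<phi> x"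
    using rec_C sA \<phi> unfolding receptive_def by blast
  ultimately show ?thesis by simp
qed

end

section \<open>Extension of morphisms from abelian maximal subgroups to \<open>S\<close>\<close>

context semi_invariant_fusion_system
begin

lemma abelian_image:
  assumes A: "maximal_subgroup A S" "comm_group (S\<lparr>carrier := A\<rparr>)"
    and Q: "subgroup Q S" and \<phi>: "\<phi> \<in> F A Q"
  shows "maximal_subgroup (\<phi> ` A) S" "comm_group (S\<lparr>carrier := \<phi> ` A\<rparr>)"
proof -
  have sA: "subgroup A S" using maximal_imp_subgroup[OF A(1)] .
  have im: "subgroup (\<phi> ` A) S" using morphism_image_subgroup[OF sA Q \<phi>] .
  show "maximal_subgroup (\<phi> ` A) S"
    using maximal_subgroup_card[OF A(1) im] card_image[OF morphism_inj[OF sA Q \<phi>]] by simp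
  have "x \<otimes> y = y \<otimes> x" if "x \<in> \<phi> ` A" "y \<in> \<phi> ` A" for x y
    using that abelian_commute[OF A(2)] morphism_mult[OF sA Q \<phi>, symmetric] by auto
  then show "comm_group (S\<lparr>carrier := \<phi> ` A\<rparr>)"
    using subgroup.subgroup_is_group[OF im is_group] by (intro group.group_comm_groupI) auto
qed

text \<open>The isomorphism from \<open>A\<close> to the good representative \<open>C\<close>
  extends to Aut_F(S), whose elements leave the maximal subgroup \<open>A\<close> invariant. Hence C
  = A.\<close>

lemma abelian_maximal_receptive:
  assumes A: "maximal_subgroup A S" "comm_group (S\<lparr>carrier := A\<rparr>)" and ne: "center S \<noteq> carrier S"
  shows "receptive_abelian_maximal p S F M N A"
proof -
  have sA: "subgroup A S" using maximal_imp_subgroup[OF A(1)] .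
  obtain C \<phi> where C: "subgroup C S" "\<phi> \<in> F A C" "\<phi> ` A = C" "fully_automized p S F C" "receptive S F C"
    using saturated[OF sA] by blast
  have mC: "maximal_subgroup C S" "comm_group (S\<lparr>carrier := C\<rparr>)"
    using abelian_image[OF A C(1,2)] C(3) by auto
  interpret C: receptive_abelian_maximal p S F M N C
    by (intro receptive_abelian_maximal.intro receptive_abelian_maximal_axioms.intro
        semi_invariant_fusion_system_axioms mC ne C(4,5))
  obtain \<alpha> where \<alpha>: "\<alpha> \<in> F (carrier S) (carrier S)" "\<forall>x\<in>A. \<alpha> x = \<phi> x"
    using C.iso_extends[OF A(1) C(2,3)] by blast
  have "\<phi> ` A = \<alpha> ` A" using \<alpha>(2) by (intro image_cong) auto
  then have "C = A" using maximal_image[OF A(1) \<alpha>(1)] C(3) by simp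
  then show ?thesis using C.receptive_abelian_maximal_axioms by simp
qed

text \<open>Receptivity of \<open>A\<close> extends isomorphisms onto \<open>A\<close>, so it is
  applied first to the inverse of \<phi>. Its extension leaves the maximal subgroup \<phi>(A)
  invariant, so \<phi>(A) = A, and then \<phi> itself is an isomorphism onto
  \<open>A\<close>.\<close>

lemma abelian_maximal_morphism_extends:
  assumes A: "maximal_subgroup A S" "comm_group (S\<lparr>carrier := A\<rparr>)" and ne: "center S \<noteq> carrier S"
    and Q: "subgroup Q S" and \<phi>: "\<phi> \<in> F A Q"
  shows "\<exists>\<alpha>\<in>F (carrier S) (carrier S). \<forall>x\<in>A. \<alpha> x = \<phi> x"
proof -
  interpret A: receptive_abelian_maximal p S F M N A using abelian_maximal_receptive[OF A ne] .
  have sA: "subgroup A S" using maximal_imp_subgroup[OF A(1)] .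
  let ?B = "\<phi> ` A" and ?\<psi> = "restrict (inv_into A \<phi>) (\<phi> ` A)"
  have B: "maximal_subgroup ?B S" using abelian_image[OF A Q \<phi>] by simp
  have \<psi>: "?\<psi> \<in> F ?B A" "\<phi> \<in> F A ?B" using iso_onto_image[OF sA Q \<phi>] by auto
  have im: "?\<psi> ` ?B = A"
    using inv_into_image_cancel[OF morphism_inj[OF sA Q \<phi>], of A] by (simp add: image_restrict_eq)
  obtain \<alpha> where \<alpha>: "\<alpha> \<in> F (carrier S) (carrier S)" "\<forall>x\<in>?B. \<alpha> x = ?\<psi> x"
    using A.iso_extends[OF B \<psi>(1) im] by blast
  have "?\<psi> ` ?B = \<alpha> ` ?B" using \<alpha>(2) by (intro image_cong) auto
  then have "?B = A" using maximal_image[OF B \<alpha>(1)] im by simp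
  then show ?thesis using A.iso_extends[OF A(1), of \<phi>] \<psi>(2) by simp
qed

end

subsection \<open>Control of fusion by automorphisms of \<open>S\<close>\<close>

lemma (in group) mem_normalizer_iff:
  assumes Q: "Q \<subseteq> carrier G"
  shows "g \<in> normalizer G Q \<longleftrightarrow> g \<in> carrier G \<and> (\<lambda>x. g \<otimes> x \<otimes> inv g) ` Q = Q"
proof -
  have "g <# Q #> inv g = (\<lambda>x. g \<otimes> x \<otimes> inv g) ` Q"
    by (auto simp: l_coset_def r_coset_def)
  then show ?thesis using Q by (simp add: normalizer_def stabilizer_def)
qed

context fusion_system
begin

text \<open>The axioms for morphisms apply only between subgroups, so this is needed before an
  extension to N_\<phi> can be restricted to a centralizer.\<close>

lemma subgroup_extension_domain:
  assumes Q: "subgroup Q S" and P: "subgroup P S" and \<phi>: "\<phi> \<in> F Q P" "\<phi> ` Q = P"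
  shows "subgroup (extension_domain S Q P \<phi>) S"
proof (rule finite_subgroupI[OF finite_carrier])
  let ?E = "extension_domain S Q P \<phi>"
  note QS = subgroup.subset[OF Q]
  have N: "subgroup (normalizer S Q) S" using normalizer_imp_subgroup[OF QS] .
  show "?E \<subseteq> carrier S" using subgroup.subset[OF N] by (auto simp: extension_domain_def)
  have "\<one> \<in> center S" using subgroup.one_closed[OF subgroup_center] .
  then have "conj_transport S Q P \<phi> \<one> \<in> conj_hom S P P"
    using conj_transport_central[OF Q P \<phi>] subgroup.mem_carrier[OF P]
    by (auto simp: conj_hom_def intro!: exI[of _ \<one>] restrict_ext)
  then show "?E \<noteq> {}" using subgroup.one_closed[OF N] by (auto simp: extension_domain_eq)
  fix g h assume gh: "g \<in> ?E" "h \<in> ?E"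
  have g: "g \<in> normalizer S Q" "conj_transport S Q P \<phi> g \<in> conj_hom S P P"
    and h: "h \<in> normalizer S Q" "conj_transport S Q P \<phi> h \<in> conj_hom S P P"
    using gh by (auto simp: extension_domain_eq)
  have gS: "g \<in> carrier S" and hS: "h \<in> carrier S" and hQ: "(\<lambda>x. h \<otimes> x \<otimes> inv h) ` Q = Q"
    using g(1) h(1) mem_normalizer_iff[OF QS] by auto
  obtain a where a: "a \<in> carrier S" "\<forall>x\<in>P. a \<otimes> x \<otimes> inv a \<in> P"
    "conj_transport S Q P \<phi> g = (\<lambda>x\<in>P. a \<otimes> x \<otimes> inv a)"
    using g(2) unfolding conj_hom_def by blast
  obtain b where b: "b \<in> carrier S" "\<forall>x\<in>P. b \<otimes> x \<otimes> inv b \<in> P"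
    "conj_transport S Q P \<phi> h = (\<lambda>x\<in>P. b \<otimes> x \<otimes> inv b)"
    using h(2) unfolding conj_hom_def by blast
  have ab: "a \<otimes> b \<otimes> x \<otimes> inv (a \<otimes> b) = a \<otimes> (b \<otimes> x \<otimes> inv b) \<otimes> inv a" if "x \<in> P" for x
    using a(1) b(1) subgroup.mem_carrier[OF P that] by (rule mult_conj)
  have "conj_transport S Q P \<phi> (g \<otimes> h) x = a \<otimes> b \<otimes> x \<otimes> inv (a \<otimes> b)" if x: "x \<in> P" for x
  proof -
    obtain y where y: "y \<in> Q" "x = \<phi> y" using x \<phi>(2) by auto
    have yh: "h \<otimes> y \<otimes> inv h \<in> Q" using hQ y(1) by blast
    have "conj_transport S Q P \<phi> (g \<otimes> h) x = \<phi> (g \<otimes> (h \<otimes> y \<otimes> inv h) \<otimes> inv g)"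
      using conj_transport_image[OF Q P \<phi>(1) y(1)] mult_conj[OF gS hS, of y] y QS by auto
    also have "\<dots> = a \<otimes> \<phi> (h \<otimes> y \<otimes> inv h) \<otimes> inv a"
      using conj_transport_image[OF Q P \<phi>(1) yh, of g] a(3) morphism_closed[OF Q P \<phi>(1) yh] by simp
    also have "\<phi> (h \<otimes> y \<otimes> inv h) = b \<otimes> x \<otimes> inv b"
      using conj_transport_image[OF Q P \<phi>(1) y(1), of h] b(3) x y(2) by simp
    finally show ?thesis using ab[OF x] by simp
  qed
  then have "conj_transport S Q P \<phi> (g \<otimes> h) = (\<lambda>x\<in>P. a \<otimes> b \<otimes> x \<otimes> inv (a \<otimes> b))"
    by (intro extensionalityI[where A = P]) (auto simp: conj_transport_def)
  moreover have "\<forall>x\<in>P. a \<otimes> b \<otimes> x \<otimes> inv (a \<otimes> b) \<in> P" using a(2) b(2) ab by simp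
  ultimately have "conj_transport S Q P \<phi> (g \<otimes> h) \<in> conj_hom S P P"
    unfolding conj_hom_def using a(1) b(1) by blast
  then show "g \<otimes> h \<in> ?E" using subgroup.m_closed[OF N g(1) h(1)] by (simp add: extension_domain_eq)
qed

lemma centralizer_le_extension_domain:
  assumes Q: "subgroup Q S" and P: "subgroup P S" and \<phi>: "\<phi> \<in> F Q P" "\<phi> ` Q = P"
    and g: "g \<in> carrier S" "\<And>v. v \<in> Q \<Longrightarrow> g \<otimes> v = v \<otimes> g"
  shows "g \<in> extension_domain S Q P \<phi>"
proof -
  have QS: "v \<in> carrier S" if "v \<in> Q" for v using subgroup.mem_carrier[OF Q that] .
  have fix_g: "g \<otimes> v \<otimes> inv g = v" if "v \<in> Q" for v
    using conj_fixes_iff_commute[OF g(1) QS[OF that]] g(2)[OF that] by simp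
  have "conj_transport S Q P \<phi> g x = \<one> \<otimes> x \<otimes> inv \<one>" if x: "x \<in> P" for x
  proof -
    obtain y where y: "y \<in> Q" "x = \<phi> y" using x \<phi>(2) by auto
    then show ?thesis
      using conj_transport_image[OF Q P \<phi>(1) y(1), of g] fix_g[OF y(1)] subgroup.mem_carrier[OF P x] by simp
  qed
  then have "conj_transport S Q P \<phi> g = (\<lambda>x\<in>P. \<one> \<otimes> x \<otimes> inv \<one>)"
    by (intro extensionalityI[where A = P]) (auto simp: conj_transport_def)
  moreover have "\<forall>x\<in>P. \<one> \<otimes> x \<otimes> inv \<one> \<in> P" using subgroup.mem_carrier[OF P] by simp
  ultimately have "conj_transport S Q P \<phi> g \<in> conj_hom S P P"
    unfolding conj_hom_def using one_closed by blast
  moreover have "g \<in> normalizer S Q"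
    using g(1) fix_g mem_normalizer_iff[OF subgroup.subset[OF Q]] by simp
  ultimately show ?thesis by (simp add: extension_domain_eq)
qed

lemma strongly_closed_one: "strongly_closed S F {\<one>}"
  unfolding strongly_closed_def
proof (intro conjI allI impI ballI)
  show "subgroup {\<one>} S" by (rule triv_subgroup)
  fix P \<phi> assume P: "subgroup P S \<and> P \<subseteq> {\<one>}" and \<phi>: "\<phi> \<in> F P (carrier S)"
  then show "\<phi> ` P \<subseteq> {\<one>}" using morphism_one[OF _ subgroup_self \<phi>] by auto
qed

lemma strongly_closed_carrier: "strongly_closed S F (carrier S)"
  unfolding strongly_closed_def using morphism_closed[OF _ subgroup_self] subgroup_self by blast

end

lemma (in group) cyclic_group_Mod:
  assumes Y: "subgroup Y G" and V: "V \<lhd> (G\<lparr>carrier := Y\<rparr>)" and c: "c \<in> Y"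
    and gen: "\<And>y. y \<in> Y \<Longrightarrow> \<exists>x\<in>V. \<exists>k::int. y = x \<otimes> c [^] k"
  shows "cyclic_group (G\<lparr>carrier := Y\<rparr> Mod V)"
proof -
  let ?Y = "G\<lparr>carrier := Y\<rparr>"
  interpret V: normal V ?Y by fact
  interpret Q: group "?Y Mod V" by (rule V.factorgroup_is_group)
  have cY: "c \<in> carrier ?Y" using c by simp
  have pow: "(V #>\<^bsub>?Y\<^esub> c) [^]\<^bsub>?Y Mod V\<^esub> k = V #>\<^bsub>?Y\<^esub> (c [^] k)" for k :: int
    using V.FactGroup_int_pow[OF cY, of k] int_pow_consistent[OF Y c, of k] by simp
  have cpow: "c [^] k \<in> carrier ?Y" for k :: int using subgroup_int_pow_closed[OF Y c] by simp
  have "R \<in> range (\<lambda>k::int. (V #>\<^bsub>?Y\<^esub> c) [^]\<^bsub>?Y Mod V\<^esub> k)" if R: "R \<in> carrier (?Y Mod V)" for R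
  proof -
    obtain y where y: "y \<in> Y" "R = V #>\<^bsub>?Y\<^esub> y" using R by (auto simp: carrier_FactGroup)
    obtain x k where xk: "x \<in> V" "y = x \<otimes> c [^] (k::int)" using gen[OF y(1)] by blast
    have "y \<in> V #>\<^bsub>?Y\<^esub> (c [^] k)" using xk by (auto simp: r_coset_def)
    then have "V #>\<^bsub>?Y\<^esub> y = V #>\<^bsub>?Y\<^esub> (c [^] k)"
      using V.repr_independence[OF _ cpow V.subgroup_axioms] by simp
    then show ?thesis using y(2) pow by auto
  qed
  moreover have "(V #>\<^bsub>?Y\<^esub> c) [^]\<^bsub>?Y Mod V\<^esub> k \<in> carrier (?Y Mod V)" for k :: int
    unfolding pow using cpow by (simp add: carrier_FactGroup)
  ultimately have "carrier (?Y Mod V) = range (\<lambda>k::int. (V #>\<^bsub>?Y\<^esub> c) [^]\<^bsub>?Y Mod V\<^esub> k)" by blast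
  moreover have "V #>\<^bsub>?Y\<^esub> c \<in> carrier (?Y Mod V)" using c by (simp add: carrier_FactGroup)
  ultimately show ?thesis unfolding Q.cyclic_group by blast
qed

context semi_invariant_fusion_system
begin

text \<open>The centralizer of \<open>x\<close> centralizes \<open>V\<close>, so it lies in N_\<phi>
  and \<phi> extends to it. It is either \<open>S\<close> or an abelian maximal subgroup, and in the
  latter case the morphism extends further to \<open>S\<close>.\<close>

lemma receptive_image_of_central_element:
  assumes V: "subgroup V S" and Q: "subgroup Q S" and \<phi>: "\<phi> \<in> F V Q" "\<phi> ` V = Q" and rec: "receptive S F Q"
    and x: "x \<in> V" and cent: "\<And>g v. g \<in> centralizer S x \<Longrightarrow> v \<in> V \<Longrightarrow> g \<otimes> v = v \<otimes> g"
  shows "\<exists>\<alpha>\<in>F (carrier S) (carrier S). \<alpha> x = \<phi> x"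
proof -
  let ?E = "extension_domain S V Q \<phi>"
  have xS: "x \<in> carrier S" using subgroup.mem_carrier[OF V x] .
  obtain \<psi> where \<psi>: "\<psi> \<in> F ?E (carrier S)" "\<forall>v\<in>V. \<psi> v = \<phi> v"
    using rec V \<phi> unfolding receptive_def by blast
  have E: "subgroup ?E S" using subgroup_extension_domain[OF V Q \<phi>] .
  let ?A = "centralizer S x"
  have A: "subgroup ?A S" using subgroup_centralizer[OF xS] .
  have AE: "?A \<subseteq> ?E"
    using centralizer_le_extension_domain[OF V Q \<phi> _ cent] subgroup.mem_carrier[OF A] by blast
  have r: "restrict \<psi> ?A \<in> F ?A (carrier S)" using restrict_morphism[OF E subgroup_self \<psi>(1) A AE] .
  have xA: "x \<in> ?A" using xS by (simp add: centralizer_def)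
  show ?thesis
  proof (cases "x \<in> center S")
    case True
    then have "?A = carrier S" using center_commute[OF True] by (auto simp: centralizer_def)
    then have "restrict \<psi> ?A \<in> F (carrier S) (carrier S)" using r by simp
    moreover have "restrict \<psi> ?A x = \<phi> x" using xA \<psi>(2) x by simp
    ultimately show ?thesis by blast
  next
    case False
    then have ne: "center S \<noteq> carrier S" using xS by blast
    obtain \<alpha> where \<alpha>: "\<alpha> \<in> F (carrier S) (carrier S)" "\<forall>v\<in>?A. \<alpha> v = restrict \<psi> ?A v"
      using abelian_maximal_morphism_extends[OF centralizer_maximal[OF xS False] ne subgroup_self r] by blast
    have "\<alpha> x = \<phi> x" using bspec[OF \<alpha>(2) xA] bspec[OF \<psi>(2) x] xA by simp
    then show ?thesis using \<alpha>(1) by blast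
  qed
qed

text \<open>\<open>x\<close> and \<open>\<phi> x\<close> generate F-conjugate cyclic subgroups, so
  both subgroups map onto one receptive \<open>Q\<close>, with the two generators going to the same
  \<theta> x. Elements \<alpha> and \<beta> of Aut_F(S) realize these two maps on the generators,
  and \<beta>^-1 \<alpha> takes \<open>x\<close> to \<open>\<phi> x\<close>.\<close>

lemma fusion_controlled_by_aut:
  assumes P: "subgroup P S" and \<phi>: "\<phi> \<in> F P (carrier S)" and x: "x \<in> P"
  shows "\<exists>\<alpha>\<in>F (carrier S) (carrier S). \<alpha> x = \<phi> x"
proof -
  note sS = subgroup_self
  have xS: "x \<in> carrier S" using subgroup.mem_carrier[OF P x] .
  let ?V = "generate S {x}"
  have V: "subgroup ?V S" using generate_is_subgroup[of "{x}"] xS by simp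
  have xX: "x \<in> ?V" by (simp add: generate.incl)
  have XP: "?V \<subseteq> P" using generate_subgroup_incl[OF _ P, of "{x}"] x by simp
  let ?\<phi> = "restrict \<phi> ?V"
  have \<phi>V: "?\<phi> \<in> F ?V (carrier S)" using restrict_morphism[OF P sS \<phi> V XP] .
  let ?Y = "?\<phi> ` ?V"
  have Y: "subgroup ?Y S" using morphism_image_subgroup[OF V sS \<phi>V] .
  have \<phi>inv: "restrict (inv_into ?V ?\<phi>) ?Y \<in> F ?Y ?V" using iso_onto_image[OF V sS \<phi>V] by simp
  have invim: "restrict (inv_into ?V ?\<phi>) ?Y ` ?Y = ?V"
    using inv_into_image_cancel[OF morphism_inj[OF V sS \<phi>V], of ?V] by (simp add: image_restrict_eq)
  obtain Q \<theta> where Q: "subgroup Q S" "\<theta> \<in> F ?V Q" "\<theta> ` ?V = Q" "receptive S F Q"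
    using saturated[OF V] by blast
  have "\<exists>\<alpha>\<in>F (carrier S) (carrier S). \<alpha> x = \<theta> x"
  proof (rule receptive_image_of_central_element[OF V Q xX])
    fix g v assume g: "g \<in> centralizer S x" and v: "v \<in> ?V"
    have gS: "g \<in> carrier S" using g by (simp add: centralizer_def)
    have "?V \<subseteq> centralizer S g"
      using g xS by (intro generate_subgroup_incl[OF _ subgroup_centralizer[OF gS]]) (simp add: centralizer_def)
    then have "v \<in> centralizer S g" using v by blast
    then show "g \<otimes> v = v \<otimes> g" by (simp add: centralizer_def)
  qed
  then obtain \<alpha> where \<alpha>: "\<alpha> \<in> F (carrier S) (carrier S)" "\<alpha> x = \<theta> x" by blast
  let ?\<theta> = "compose ?Y \<theta> (restrict (inv_into ?V ?\<phi>) ?Y)"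
  have \<theta>': "?\<theta> \<in> F ?Y Q" using compose_morphism[OF Y V Q(1) \<phi>inv Q(2)] .
  have \<theta>'im: "?\<theta> ` ?Y = Q"
  proof -
    have "?\<theta> ` ?Y = \<theta> ` (restrict (inv_into ?V ?\<phi>) ?Y ` ?Y)" by (auto simp: compose_def)
    then show ?thesis using invim Q(3) by simp
  qed
  have yY: "\<phi> x \<in> ?Y" using xX by (metis imageI restrict_apply')
  have \<theta>y: "?\<theta> (\<phi> x) = \<theta> x"
    using yY inv_into_f_f[OF morphism_inj[OF V sS \<phi>V] xX] xX by (simp add: compose_def)
  have "\<exists>\<beta>\<in>F (carrier S) (carrier S). \<beta> (\<phi> x) = ?\<theta> (\<phi> x)"
  proof (rule receptive_image_of_central_element[OF Y Q(1) \<theta>' \<theta>'im Q(4) yY])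
    fix g v assume g: "g \<in> centralizer S (\<phi> x)" and v: "v \<in> ?Y"
    have gS: "g \<in> carrier S" using g by (simp add: centralizer_def)
    \<comment> \<open>\<open>?Y\<close> is known as an image, not through a generator, so the
      condition is pulled back to \<open>?V\<close>, where containing x suffices.\<close>
    let ?Z = "{v \<in> ?V. ?\<phi> v \<in> centralizer S g}"
    have "\<phi> x \<in> carrier S" using morphism_closed[OF P sS \<phi> x] .
    then have xZ: "x \<in> ?Z" using g xX by (simp add: centralizer_def)
    have "subgroup ?Z S"
    proof (rule finite_subgroupI[OF finite_carrier])
      show "?Z \<noteq> {}" using xZ by blast
      fix a b assume "a \<in> ?Z" "b \<in> ?Z"
      then have a: "a \<in> ?V" "?\<phi> a \<in> centralizer S g" and b: "b \<in> ?V" "?\<phi> b \<in> centralizer S g"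
        by blast+
      have "?\<phi> (a \<otimes> b) \<in> centralizer S g"
        unfolding morphism_mult[OF V sS \<phi>V a(1) b(1)]
        using subgroup.m_closed[OF subgroup_centralizer[OF gS] a(2) b(2)] .
      then show "a \<otimes> b \<in> ?Z" using subgroup.m_closed[OF V a(1) b(1)] by blast
    qed (use subgroup.subset[OF V] in blast)
    moreover have "{x} \<subseteq> ?Z" using xZ by blast
    ultimately have "?V \<subseteq> ?Z" by (intro generate_subgroup_incl)
    then have "v \<in> centralizer S g" using v by blast
    then show "g \<otimes> v = v \<otimes> g" by (simp add: centralizer_def)
  qed
  then obtain \<beta> where \<beta>: "\<beta> \<in> F (carrier S) (carrier S)" "\<beta> (\<phi> x) = \<theta> x" using \<theta>y by auto
  have yS: "\<phi> x \<in> carrier S" using morphism_closed[OF P sS \<phi> x] .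
  let ?i = "restrict (inv_into (carrier S) \<beta>) (carrier S)"
  have i: "?i \<in> F (carrier S) (carrier S)" using inverse_morphism[OF sS sS \<beta>(1) endo_image[OF sS \<beta>(1)]] .
  have "compose (carrier S) ?i \<alpha> \<in> F (carrier S) (carrier S)"
    using compose_morphism[OF sS sS sS \<alpha>(1) i] .
  moreover have "compose (carrier S) ?i \<alpha> x = \<phi> x"
    using xS \<alpha>(2) \<beta>(2) inv_into_f_f[OF morphism_inj[OF sS sS \<beta>(1)] yS]
      morphism_closed[OF sS sS \<alpha>(1) xS] by (simp add: compose_def)
  ultimately show ?thesis by blast
qed

lemma strongly_closedI:
  assumes T: "subgroup T S" and inv: "\<And>\<alpha> x. \<alpha> \<in> F (carrier S) (carrier S) \<Longrightarrow> x \<in> T \<Longrightarrow> \<alpha> x \<in> T"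
  shows "strongly_closed S F T"
  unfolding strongly_closed_def
proof (intro conjI T allI impI ballI subsetI)
  fix P \<phi> y assume P: "subgroup P S \<and> P \<subseteq> T" and \<phi>: "\<phi> \<in> F P (carrier S)" and "y \<in> \<phi> ` P"
  then obtain x where x: "x \<in> P" "y = \<phi> x" by blast
  then obtain \<alpha> where "\<alpha> \<in> F (carrier S) (carrier S)" "\<alpha> x = \<phi> x"
    using fusion_controlled_by_aut P \<phi> by blast
  then show "y \<in> T" using inv P x by (metis subsetD)
qed

subsection \<open>The series of strongly closed subgroups\<close>

text \<open>For a subgroup \<open>H\<close> this is the product of \<open>D\<close> and the group
  generated by q-th powers from \<open>H\<close>: since S/D is abelian, taking q-th powers is
  multiplicative modulo \<open>D\<close>, and the bare set of products is already a
  subgroup.\<close>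

definition power_subgroup :: "nat \<Rightarrow> 'a set \<Rightarrow> 'a set" where
  "power_subgroup q H = {d \<otimes> h [^] q | d h. d \<in> D \<and> h \<in> H}"

lemma derived_carrier: "d \<in> D \<Longrightarrow> d \<in> carrier S"
  using subgroup.mem_carrier[OF subgroup_derived] .

lemma mult_pow_mod_derived:
  assumes x: "x \<in> carrier S" and y: "y \<in> carrier S"
  shows "\<exists>d\<in>D. (x \<otimes> y) [^] (n::nat) = d \<otimes> x [^] n \<otimes> y [^] n"
proof (induction n)
  case 0
  then show ?case using subgroup.one_closed[OF subgroup_derived] by (intro bexI[of _ \<one>]) auto
next
  case (Suc n)
  then obtain d where d: "d \<in> D" "(x \<otimes> y) [^] n = d \<otimes> x [^] n \<otimes> y [^] n" by blast
  let ?c = "commutator S (y [^] n) x"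
  have c: "?c \<in> D" using commutator_derived x y by simp
  have cS: "?c \<in> carrier S" and dS: "d \<in> carrier S" using c d derived_carrier by auto
  have "(x \<otimes> y) [^] Suc n = d \<otimes> x [^] n \<otimes> (y [^] n \<otimes> x) \<otimes> y"
    using d(2) x y dS by (simp add: m_assoc)
  also have "y [^] n \<otimes> x = ?c \<otimes> x \<otimes> y [^] n"
    using x y by (simp add: commutator_def m_assoc)
  also have "d \<otimes> x [^] n \<otimes> (?c \<otimes> x \<otimes> y [^] n) \<otimes> y = d \<otimes> (x [^] n \<otimes> ?c) \<otimes> x \<otimes> (y [^] n \<otimes> y)"
    using x y cS dS by (simp add: m_assoc)
  also have "x [^] n \<otimes> ?c = ?c \<otimes> x [^] n"
    using center_commute[of ?c "x [^] n"] c derived_central x by auto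
  finally have "(x \<otimes> y) [^] Suc n = (d \<otimes> ?c) \<otimes> x [^] Suc n \<otimes> y [^] Suc n"
    using x y cS dS by (simp add: m_assoc)
  then show ?case using subgroup.m_closed[OF subgroup_derived d(1) c] by blast
qed

lemma subgroup_power_subgroup:
  assumes H: "subgroup H S"
  shows "subgroup (power_subgroup q H) S"
proof (rule finite_subgroupI[OF finite_carrier])
  note HS = subgroup.mem_carrier[OF H]
  show "power_subgroup q H \<subseteq> carrier S" using HS derived_carrier by (auto simp: power_subgroup_def)
  show "power_subgroup q H \<noteq> {}"
    using subgroup.one_closed[OF H] subgroup.one_closed[OF subgroup_derived] by (auto simp: power_subgroup_def)
  fix a b assume "a \<in> power_subgroup q H" "b \<in> power_subgroup q H"
  then obtain d h d' h' where a: "a = d \<otimes> h [^] q" "d \<in> D" "h \<in> H"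
    and b: "b = d' \<otimes> h' [^] q" "d' \<in> D" "h' \<in> H" by (auto simp: power_subgroup_def)
  obtain e where e: "e \<in> D" "(h \<otimes> h') [^] q = e \<otimes> h [^] q \<otimes> h' [^] q"
    using mult_pow_mod_derived HS a(3) b(3) by blast
  have S: "d \<in> carrier S" "d' \<in> carrier S" "e \<in> carrier S" "h [^] q \<in> carrier S" "h' [^] q \<in> carrier S"
    using a b e HS derived_carrier by auto
  have "h [^] q \<otimes> h' [^] q = inv e \<otimes> (h \<otimes> h') [^] q" using e S by (simp add: m_assoc cancel_left_mult)
  moreover have "a \<otimes> b = d \<otimes> (h [^] q \<otimes> d') \<otimes> h' [^] q" using a b S by (simp add: m_assoc)
  moreover have "h [^] q \<otimes> d' = d' \<otimes> h [^] q"
    using center_commute[of d' "h [^] q"] b(2) derived_central S by auto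
  ultimately have "a \<otimes> b = (d \<otimes> d' \<otimes> inv e) \<otimes> (h \<otimes> h') [^] q"
    using S HS a(3) b(3) by (simp add: m_assoc)
  moreover have "d \<otimes> d' \<otimes> inv e \<in> D"
    using a b e subgroup.m_closed[OF subgroup_derived] subgroup.m_inv_closed[OF subgroup_derived] by blast
  ultimately show "a \<otimes> b \<in> power_subgroup q H"
    using subgroup.m_closed[OF H a(3) b(3)] unfolding power_subgroup_def by (intro CollectI exI conjI)
qed

lemma derived_le_power_subgroup:
  assumes "subgroup H S"
  shows "D \<subseteq> power_subgroup q H"
proof
  fix d assume "d \<in> D"
  then have "d = d \<otimes> \<one> [^] q" using derived_carrier by simp
  then show "d \<in> power_subgroup q H"
    using \<open>d \<in> D\<close> subgroup.one_closed[OF assms] unfolding power_subgroup_def by blast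
qed

lemma power_mem_power_subgroup: "h \<in> H \<Longrightarrow> h \<in> carrier S \<Longrightarrow> h [^] q \<in> power_subgroup q H"
  using subgroup.one_closed[OF subgroup_derived] unfolding power_subgroup_def
  by (intro CollectI exI[of _ \<one>] exI[of _ h]) simp

lemma derived_normal:
  assumes H: "subgroup H S" and D: "D \<subseteq> H" and h: "h \<in> H" and x: "x \<in> carrier S"
  shows "x \<otimes> h \<otimes> inv x \<in> H"
  using conj_eq_commutator_mult[OF x subgroup.mem_carrier[OF H h]]
    subgroup.m_closed[OF H subsetD[OF D commutator_derived[OF x subgroup.mem_carrier[OF H h]]] h]
  by simp

lemma subgroup_adjoin_derived:
  assumes H: "subgroup H S" and D: "D \<subseteq> H" and y: "y \<in> carrier S"
  shows "subgroup {h \<otimes> y [^] (k::int) | h k. h \<in> H} S"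
  using subgroup_adjoin[OF H y derived_normal[OF H D _ y]] derived_normal[OF H D _ inv_closed[OF y]] y by simp

text \<open>Every subgroup containing \<open>D S\<^sup>p\<close> is thus an intersection of maximal subgroups, hence \<open>Aut\<^sub>\<F>(S)\<close>-invariant.\<close>

lemma separating_maximal_subgroup:
  assumes H: "subgroup H S" and E: "power_subgroup p (carrier S) \<subseteq> H" and y: "y \<in> carrier S" "y \<notin> H"
  obtains L where "maximal_subgroup L S" "H \<subseteq> L" "y \<notin> L"
proof -
  let ?U = "{L. subgroup L S \<and> H \<subseteq> L \<and> y \<notin> L}"
  have "finite ?U"
    using finite_subset[of ?U "Pow (carrier S)"] finite_carrier subgroup.subset by blast
  moreover have "H \<in> ?U" using H y by simp
  \<comment> \<open>\<open>L\<close> is maximal among the subgroups that contain \<open>H\<close>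
    and avoid y; the claim is that it is then maximal in \<open>S\<close>.\<close>
  ultimately obtain L where L: "L \<in> ?U" "\<And>L'. L' \<in> ?U \<Longrightarrow> L \<subseteq> L' \<Longrightarrow> L = L'"
    using finite_has_maximal2[of ?U H] by auto
  have sL: "subgroup L S" "H \<subseteq> L" "y \<notin> L" using L(1) by auto
  have DL: "D \<subseteq> L" using derived_le_power_subgroup[OF subgroup_self] E sL(2) by blast
  have "maximal_subgroup L S"
    unfolding maximal_subgroup_def
  proof (intro conjI sL(1) allI impI)
    show "L \<noteq> carrier S" using y sL by blast
    fix L' assume L': "subgroup L' S" "L \<subseteq> L'"
    show "L' = L \<or> L' = carrier S"
    proof (rule disjCI, rule ccontr)
      assume ne: "L' \<noteq> carrier S" "L' \<noteq> L"
      have yL': "y \<in> L'" using L(2)[of L'] L' sL(2) ne(2) by blast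
      obtain z where z: "z \<in> carrier S" "z \<notin> L'" using ne(1) subgroup.subset[OF L'(1)] by blast
      \<comment> \<open>By the choice of \<open>L\<close>, adjoining z captures y, say y = l z^k. As
        z^p is in \<open>L\<close>, the exponent k is prime to p. But \<open>L'\<close> contains y
        and l, hence z^k, hence z, against the choice of z.\<close>
      let ?Lz = "{h \<otimes> z [^] (k::int) | h k. h \<in> L}"
      have Lz: "subgroup ?Lz S" using subgroup_adjoin_derived[OF sL(1) DL z(1)] .
      have mem: "L \<subseteq> ?Lz" "z \<in> ?Lz" by (rule mem_adjoin[OF sL(1) z(1)])+
      have "y \<in> ?Lz"
      proof (rule ccontr)
        assume "y \<notin> ?Lz"
        then have "?Lz \<in> ?U" using Lz mem(1) sL(2) by simp
        then have "L = ?Lz" using L(2) mem(1) by (metis (no_types, lifting))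
        then show False using mem(2) z(2) L'(2) by auto
      qed
      then obtain l k where lk: "y = l \<otimes> z [^] (k::int)" "l \<in> L" by blast
      have lS: "l \<in> carrier S" using subgroup.mem_carrier[OF sL(1) lk(2)] .
      have "\<not> int p dvd k"
      proof
        assume "int p dvd k"
        then obtain j where j: "k = int p * j" by auto
        have "z [^] p \<in> L" using power_mem_power_subgroup[OF z(1) z(1), of p] E sL(2) by blast
        then have "(z [^] p) [^] j \<in> L" by (rule subgroup_int_pow_closed[OF sL(1)])
        then have "z [^] k \<in> L" using z(1) j by (simp add: int_pow_pow flip: int_pow_int)
        then show False using lk sL(3) subgroup.m_closed[OF sL(1)] by blast
      qed
      moreover have "z [^] k = inv l \<otimes> y" using lk(1) lS z(1) by (simp add: cancel_left_mult)
      then have "z [^] k \<in> L'"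
        using subgroup.m_closed[OF L'(1) subgroup.m_inv_closed[OF L'(1)] yL'] lk(2) L'(2) by auto
      ultimately have "z \<in> L'" using int_pow_coprime_mem[OF L'(1) z(1)] by blast
      then show False using z(2) by simp
    qed
  qed
  then show thesis using that sL by blast
qed

lemma aut_invariant:
  assumes H: "subgroup H S" and E: "power_subgroup p (carrier S) \<subseteq> H"
    and \<alpha>: "\<alpha> \<in> F (carrier S) (carrier S)" and x: "x \<in> H"
  shows "\<alpha> x \<in> H"
proof (rule ccontr)
  assume "\<alpha> x \<notin> H"
  moreover have "\<alpha> x \<in> carrier S"
    using morphism_closed[OF subgroup_self subgroup_self \<alpha>] subgroup.mem_carrier[OF H x] .
  ultimately obtain L where L: "maximal_subgroup L S" "H \<subseteq> L" "\<alpha> x \<notin> L"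
    using separating_maximal_subgroup[OF H E] by blast
  then show False using maximal_image[OF L(1) \<alpha>] x by blast
qed

lemma derived_aut_invariant:
  assumes \<alpha>: "\<alpha> \<in> F (carrier S) (carrier S)" and x: "x \<in> D"
  shows "\<alpha> x \<in> D"
proof -
  interpret \<alpha>: group_hom "S\<lparr>carrier := carrier S\<rparr>" S \<alpha>
    using morphism_group_hom[OF subgroup_self subgroup_self \<alpha>] .
  interpret \<alpha>': group_hom S S \<alpha>
    using \<alpha>.group_hom_axioms by simp
  have "\<alpha> ` D = D"
    using \<alpha>'.derived_img[of "carrier S"] endo_image[OF subgroup_self \<alpha>] by simp
  then show ?thesis using x by blast
qed

lemma strongly_closed_power_subgroup:
  assumes H: "subgroup H S" and E: "power_subgroup p (carrier S) \<subseteq> H"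
  shows "strongly_closed S F (power_subgroup q H)"
proof (rule strongly_closedI[OF subgroup_power_subgroup[OF H]])
  fix \<alpha> x assume \<alpha>: "\<alpha> \<in> F (carrier S) (carrier S)" and "x \<in> power_subgroup q H"
  then obtain d h where x: "x = d \<otimes> h [^] q" "d \<in> D" "h \<in> H" by (auto simp: power_subgroup_def)
  note a = morphism_mult[OF subgroup_self subgroup_self \<alpha>] morphism_nat_pow[OF subgroup_self subgroup_self \<alpha>]
  have hS: "h \<in> carrier S" using subgroup.mem_carrier[OF H x(3)] .
  have "\<alpha> x = \<alpha> d \<otimes> \<alpha> h [^] q"
    using x(1) a(1)[of d "h [^] q"] a(2)[OF hS] derived_carrier[OF x(2)] hS by simp
  then show "\<alpha> x \<in> power_subgroup q H"
    using derived_aut_invariant[OF \<alpha> x(2)] aut_invariant[OF H E \<alpha> x(3)]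
    unfolding power_subgroup_def by blast
qed

text \<open>As a relation that carries the strong closure of both ends, steps can be concatenated by
  reflexive transitive closure; an indexed series is extracted only at the end.\<close>

definition supersolvable_step :: "'a set \<Rightarrow> 'a set \<Rightarrow> bool" where
  "supersolvable_step V Y \<longleftrightarrow> strongly_closed S F V \<and> strongly_closed S F Y \<and> V \<subseteq> Y \<and>
     cyclic_group (S\<lparr>carrier := Y\<rparr> Mod V)"

lemma normal_in_subgroup:
  assumes V: "subgroup V S" and Y: "subgroup Y S" and XY: "V \<subseteq> Y"
    and norm: "\<And>x y. x \<in> V \<Longrightarrow> y \<in> Y \<Longrightarrow> y \<otimes> x \<otimes> inv y \<in> V"
  shows "V \<lhd> (S\<lparr>carrier := Y\<rparr>)"
proof -
  interpret Y: group "S\<lparr>carrier := Y\<rparr>" using subgroup.subgroup_is_group[OF Y is_group] .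
  have "subgroup V (S\<lparr>carrier := Y\<rparr>)" using subgroup_incl[OF V Y XY] .
  then show ?thesis unfolding Y.normal_inv_iff using norm Y by simp
qed

text \<open>Modulo \<open>D\<close> one has (h y^k)^q = h^q (y^q)^k, so y^q generates the quotient.
  Both ends are strongly closed because \<open>H\<close> and its extension by \<open>y\<close>
  contain D S^p.\<close>

lemma power_subgroup_adjoin_step:
  assumes H: "subgroup H S" and E: "power_subgroup p (carrier S) \<subseteq> H" and y: "y \<in> carrier S"
  shows "supersolvable_step (power_subgroup q H) (power_subgroup q {h \<otimes> y [^] (k::int) | h k. h \<in> H})"
    (is "supersolvable_step ?V (power_subgroup q ?H')")
proof -
  let ?Y = "power_subgroup q ?H'"
  have DH: "D \<subseteq> H" using derived_le_power_subgroup[OF subgroup_self] E by blast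
  have H': "subgroup ?H' S" using subgroup_adjoin_derived[OF H DH y] .
  have HH': "H \<subseteq> ?H'" "y \<in> ?H'" by (rule mem_adjoin[OF H y])+
  have V: "subgroup ?V S" and Y: "subgroup ?Y S" using subgroup_power_subgroup H H' by blast+
  have DX: "D \<subseteq> ?V" using derived_le_power_subgroup[OF H] .
  have XY: "?V \<subseteq> ?Y" using HH'(1) unfolding power_subgroup_def by blast
  have "cyclic_group (S\<lparr>carrier := ?Y\<rparr> Mod ?V)"
  proof (rule cyclic_group_Mod[OF Y])
    show "?V \<lhd> (S\<lparr>carrier := ?Y\<rparr>)"
      using derived_normal[OF V DX] subgroup.mem_carrier[OF Y] by (intro normal_in_subgroup[OF V Y XY]) blast
    show "y [^] q \<in> ?Y" using power_mem_power_subgroup[OF HH'(2) y] .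
    fix v assume "v \<in> ?Y"
    then obtain d h' where v: "v = d \<otimes> h' [^] q" "d \<in> D" "h' \<in> ?H'" unfolding power_subgroup_def by blast
    obtain h k where h: "h' = h \<otimes> y [^] (k::int)" "h \<in> H" using v(3) by blast
    have hS: "h \<in> carrier S" and dS: "d \<in> carrier S"
      using subgroup.mem_carrier[OF H h(2)] derived_carrier[OF v(2)] by auto
    obtain e where e: "e \<in> D" "h' [^] q = e \<otimes> h [^] q \<otimes> (y [^] k) [^] q"
      using mult_pow_mod_derived[OF hS, of "y [^] k" q] y h(1) by auto
    have "(y [^] k) [^] q = (y [^] q) [^] k"
      using y by (simp add: int_pow_pow mult.commute flip: int_pow_int)
    then have "v = (d \<otimes> e \<otimes> h [^] q) \<otimes> (y [^] q) [^] k"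
      using v(1) e y hS dS derived_carrier[OF e(1)] by (simp add: m_assoc)
    moreover have "d \<otimes> e \<otimes> h [^] q \<in> ?V"
      using subgroup.m_closed[OF subgroup_derived v(2) e(1)] h(2) unfolding power_subgroup_def by blast
    ultimately show "\<exists>x\<in>?V. \<exists>k::int. v = x \<otimes> (y [^] q) [^] k" by blast
  qed
  moreover have "power_subgroup p (carrier S) \<subseteq> ?H'" using E HH'(1) by (rule subset_trans)
  ultimately show ?thesis
    unfolding supersolvable_step_def
    using strongly_closed_power_subgroup[OF H E] strongly_closed_power_subgroup[OF H'] XY by blast
qed

text \<open>Elements are adjoined to \<open>H\<close> one at a time until \<open>S\<close> is
  reached; each strictly enlarges \<open>H\<close> and contributes one cyclic factor to the chain of
  power subgroups.\<close>

lemma power_subgroup_chain: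
  assumes "subgroup H S" "power_subgroup p (carrier S) \<subseteq> H"
  shows "supersolvable_step\<^sup>*\<^sup>* (power_subgroup q H) (power_subgroup q (carrier S))"
  using assms
proof (induction "card (carrier S) - card H" arbitrary: H rule: less_induct)
  case less
  note H = less.prems
  show ?case
  proof (cases "H = carrier S")
    case False
    then obtain y where y: "y \<in> carrier S" "y \<notin> H" using subgroup.subset[OF H(1)] by blast
    let ?H' = "{h \<otimes> y [^] (k::int) | h k. h \<in> H}"
    have DH: "D \<subseteq> H" using derived_le_power_subgroup[OF subgroup_self] H(2) by blast
    have H': "subgroup ?H' S" using subgroup_adjoin_derived[OF H(1) DH y(1)] .
    have HH': "H \<subseteq> ?H'" "y \<in> ?H'" by (rule mem_adjoin[OF H(1) y(1)])+
    have "H \<noteq> ?H'"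
    proof
      assume eq: "H = ?H'"
      have "y \<in> H" using HH'(2) unfolding eq[symmetric] .
      then show False using y(2) by contradiction
    qed
    then have "H \<subset> ?H'" using HH'(1) by (intro psubsetI)
    then have "card H < card ?H'" using psubset_card_mono[OF finite_subgroup[OF H']] by simp
    moreover have "card ?H' \<le> card (carrier S)"
      using card_mono[OF finite_carrier subgroup.subset[OF H']] .
    ultimately have "card (carrier S) - card ?H' < card (carrier S) - card H" by linarith
    then have "supersolvable_step\<^sup>*\<^sup>* (power_subgroup q ?H') (power_subgroup q (carrier S))"
      using less.hyps[OF _ H' subset_trans[OF H(2) HH'(1)]] by simp
    then show ?thesis
      using power_subgroup_adjoin_step[OF H y(1)] by (rule converse_rtranclp_into_rtranclp[rotated])
  qed simp
qed

text \<open>This glues the chains: for H = D S^p and q = p^n, the chain ending at D S^q starts at D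
  S^(pq), where the previous exponent takes over.\<close>

lemma power_subgroup_power:
  "power_subgroup q (power_subgroup p (carrier S)) = power_subgroup (p * q) (carrier S)"
proof (intro subset_antisym subsetI)
  fix x assume "x \<in> power_subgroup q (power_subgroup p (carrier S))"
  then obtain d e h where x: "x = d \<otimes> (e \<otimes> h [^] p) [^] q" "d \<in> D" "e \<in> D" "h \<in> carrier S"
    by (auto simp: power_subgroup_def)
  have S: "d \<in> carrier S" "e \<in> carrier S" using x derived_carrier by auto
  have "e \<otimes> h [^] p = h [^] p \<otimes> e" using center_commute[of e "h [^] p"] x derived_central by auto
  then have "(e \<otimes> h [^] p) [^] q = e [^] q \<otimes> h [^] (p * q)"
    using pow_mult_distrib[of e "h [^] p" q] S x(4) by (simp add: nat_pow_pow)
  then have "x = d \<otimes> e [^] q \<otimes> h [^] (p * q)" using x S by (simp add: m_assoc)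
  moreover have "d \<otimes> e [^] q \<in> D"
    using subgroup.m_closed[OF subgroup_derived x(2)]
      subgroup_int_pow_closed[OF subgroup_derived x(3), of "int q"] by (simp add: int_pow_int)
  ultimately show "x \<in> power_subgroup (p * q) (carrier S)"
    using x(4) unfolding power_subgroup_def by blast
next
  fix x assume "x \<in> power_subgroup (p * q) (carrier S)"
  then obtain d h where x: "x = d \<otimes> h [^] (p * q)" "d \<in> D" "h \<in> carrier S"
    by (auto simp: power_subgroup_def)
  have "x = d \<otimes> (h [^] p) [^] q" using x by (simp add: nat_pow_pow)
  then show "x \<in> power_subgroup q (power_subgroup p (carrier S))"
    using x(2) power_mem_power_subgroup[OF x(3,3), of p] unfolding power_subgroup_def[of q] by blast
qed

lemma power_subgroup_carrier_chain:
  "supersolvable_step\<^sup>*\<^sup>* (power_subgroup (p ^ n) (carrier S)) (carrier S)"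
proof (induction n)
  case 0
  have "x \<in> power_subgroup 1 (carrier S)" if "x \<in> carrier S" for x
    using power_mem_power_subgroup[OF that that, of 1] that by simp
  then have "power_subgroup 1 (carrier S) = carrier S"
    using subgroup.subset[OF subgroup_power_subgroup[OF subgroup_self]] by blast
  then show ?case by simp
next
  case (Suc n)
  have "supersolvable_step\<^sup>*\<^sup>* (power_subgroup (p ^ n) (power_subgroup p (carrier S))) (power_subgroup (p ^ n) (carrier S))"
    using power_subgroup_chain[OF subgroup_power_subgroup[OF subgroup_self] subset_refl] .
  then show ?case using Suc by (simp add: power_subgroup_power)
qed

lemma derived_step: "supersolvable_step {\<one>} D"
proof -
  obtain d where d: "d \<in> center S" "d [^] p = \<one>" "D = range (\<lambda>k::int. d [^] k)" by (rule derived_cyclic)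
  have dS: "d \<in> carrier S" using d(1) by simp
  have "d [^] (1::int) \<in> D" using d(3) by blast
  then have dD: "d \<in> D" using dS by simp
  have "cyclic_group (S\<lparr>carrier := D\<rparr> Mod {\<one>})"
  proof (rule cyclic_group_Mod[OF subgroup_derived _ dD])
    show "{\<one>} \<lhd> (S\<lparr>carrier := D\<rparr>)"
      using derived_carrier subgroup.one_closed[OF subgroup_derived]
      by (intro normal_in_subgroup triv_subgroup subgroup_derived) auto
    fix y assume "y \<in> D"
    then obtain k where "y = d [^] (k::int)" using d(3) by blast
    then show "\<exists>x\<in>{\<one>}. \<exists>k::int. y = x \<otimes> d [^] k" using dS by auto
  qed
  moreover have "strongly_closed S F D"
    by (rule strongly_closedI[OF subgroup_derived]) (rule derived_aut_invariant)
  ultimately show ?thesis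
    unfolding supersolvable_step_def
    using strongly_closed_one subgroup.one_closed[OF subgroup_derived] by blast
qed

lemma supersolvable_noncyclic: "supersolvable p S F"
proof -
  obtain n where n: "order S = p ^ n" using order_power by blast
  \<comment> \<open>With the order of \<open>S\<close> as exponent all powers vanish, so the
    descending chain of power subgroups ends exactly at \<open>D\<close>.\<close>
  have "power_subgroup (p ^ n) (carrier S) \<subseteq> D"
  proof
    fix x assume "x \<in> power_subgroup (p ^ n) (carrier S)"
    then obtain d h where "x = d \<otimes> h [^] (p ^ n)" "d \<in> D" "h \<in> carrier S" by (auto simp: power_subgroup_def)
    then show "x \<in> D" using pow_order_eq_1[of h] n derived_carrier by simp
  qed
  then have "power_subgroup (p ^ n) (carrier S) = D"
    using derived_le_power_subgroup[OF subgroup_self] by blast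
  then have "supersolvable_step\<^sup>*\<^sup>* {\<one>} (carrier S)"
    using power_subgroup_carrier_chain[of n] derived_step by (simp add: converse_rtranclp_into_rtranclp)
  then obtain m where "(supersolvable_step ^^ m) {\<one>} (carrier S)"
    unfolding rtranclp_power by (rule exE)
  then obtain T where T: "T 0 = {\<one>}" "T m = carrier S"
    "\<And>i. i < m \<Longrightarrow> supersolvable_step (T i) (T (Suc i))"
    unfolding relpowp_fun_conv by blast
  \<comment> \<open>For i < m the step starting at \<open>T i\<close> gives strong closure; the last
    term starts no step, and for m = 0 it belongs to none, so it is handled as the whole of
    \<open>S\<close>.\<close>
  have "strongly_closed S F (T i)" if "i \<le> m" for i
    using that T(2,3) strongly_closed_carrier unfolding supersolvable_step_def
    by (metis le_neq_implies_less)
  then show ?thesis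
    unfolding supersolvable_def using T saturated_fusion_system_axioms unfolding supersolvable_step_def by blast
qed

end

section \<open>The cyclic case and the conclusion\<close>

lemma (in saturated_fusion_system) supersolvable_cyclic:
  assumes "cyclic_group S"
  shows "supersolvable p S F"
proof -
  obtain c where c: "c \<in> carrier S" "carrier S = range (\<lambda>n::int. c [^] n)"
    using assms cyclic_group by blast
  have "cyclic_group (S\<lparr>carrier := carrier S\<rparr> Mod {\<one>})"
  proof (rule cyclic_group_Mod[OF subgroup_self _ c(1)])
    show "{\<one>} \<lhd> (S\<lparr>carrier := carrier S\<rparr>)" by (simp add: one_is_normal)
    fix y assume y: "y \<in> carrier S"
    then obtain k where "y = c [^] (k::int)" using c(2) by blast
    then show "\<exists>x\<in>{\<one>}. \<exists>k::int. y = x \<otimes> c [^] k" using c(1) by auto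
  qed
  then have "\<exists>(n::nat) T. T 0 = {\<one>} \<and> T n = carrier S \<and> (\<forall>i\<le>n. strongly_closed S F (T i)) \<and>
      (\<forall>i<n. T i \<subseteq> T (Suc i) \<and> cyclic_group (S\<lparr>carrier := T (Suc i)\<rparr> Mod T i))"
    using strongly_closed_one strongly_closed_carrier
    by (intro exI[of _ 1] exI[of _ "\<lambda>i. if i = 0 then {\<one>} else carrier S"]) (auto simp: less_Suc_eq)
  then show ?thesis unfolding supersolvable_def using saturated_fusion_system_axioms by blast
qed

theorem theorem4p2:
  fixes p :: nat
    and S :: "('a, 'b) monoid_scheme"
    and F :: "'a set \<Rightarrow> 'a set \<Rightarrow> ('a \<Rightarrow> 'a) set"
  assumes "Factorial_Ring.prime p" and "odd p"
    and "saturated_fusion_system p S F"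
    and "\<And>M. maximal_subgroup M S \<Longrightarrow> semi_invariant S F M"
    and "\<not> cyclic_group S \<Longrightarrow>
         \<exists>M N. M \<noteq> N \<and>
           maximal_subgroup M S \<and> comm_group (S\<lparr>carrier := M\<rparr>) \<and>
           maximal_subgroup N S \<and> comm_group (S\<lparr>carrier := N\<rparr>)"
  shows "supersolvable p S F"
proof (cases "cyclic_group S")
  case True
  then show ?thesis using saturated_fusion_system.supersolvable_cyclic[OF assms(3)] by blast
next
  case False
  then obtain M N where MN: "M \<noteq> N" "maximal_subgroup M S" "comm_group (S\<lparr>carrier := M\<rparr>)"
    "maximal_subgroup N S" "comm_group (S\<lparr>carrier := N\<rparr>)"
    using assms(5) by blast
  interpret saturated_fusion_system p S F by (rule assms(3))
  interpret semi_invariant_fusion_system p S F M N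
    by (intro semi_invariant_fusion_system.intro two_abelian_maximals.intro
        two_abelian_maximals_axioms.intro semi_invariant_fusion_system_axioms.intro
        assms(2-4) finite_p_group_axioms MN)
  show ?thesis by (rule supersolvable_noncyclic)
qed

end
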